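(* Let $T$ be a tree of diameter at most $4$ which is not a star. Then $T$ satisfies the Strong Erdős–Sós conjecture; that is, writing $k=|V(T)|$, the only $T$-free graphs on $n$ vertices with $\frac{k-2}{2}\cdot n$ edges are the vertex-disjoint unions of cliques of size $k-1$.
   Context: All graphs are finite and simple. A graph is $T$-free if it has no (not necessarily induced) subgraph isomorphic to $T$. A star is a graph of the form $K_{1,t}$, $t\ge 0$. A $k$-vertex tree $T$ is said to satisfy the Strong Erdős–Sós conjecture (SESC) if, for every $n$, every $n$-vertex $T$-free graph with $\frac{k-2}{2}\cdot n$ edges is a vertex-disjoint union of complete graphs $K_{k-1}$. *)

theory Defs
  imports Complex_Main "HOL-Library.Disjoint_Sets"
begin

text \<open>
  A graph is a pair of a vertex set and an edge set; \<open>simple_graph\<close> below includes finiteness.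
\<close>

type_synonym 'a graph = "'a set \<times> 'a set set"

abbreviation verts :: "'a graph \<Rightarrow> 'a set" where
  "verts G \<equiv> fst G"

abbreviation edges :: "'a graph \<Rightarrow> 'a set set" where
  "edges G \<equiv> snd G"

definition simple_graph :: "'a graph \<Rightarrow> bool" where
  "simple_graph G \<longleftrightarrow> finite (verts G) \<and> (\<forall>e\<in>edges G. e \<subseteq> verts G \<and> card e = 2)"

definition subgraph :: "'a graph \<Rightarrow> 'a graph \<Rightarrow> bool" where
  "subgraph H G \<longleftrightarrow> simple_graph H \<and> verts H \<subseteq> verts G \<and> edges H \<subseteq> edges G"

definition isomorphic :: "'a graph \<Rightarrow> 'b graph \<Rightarrow> bool" where
  "isomorphic G H \<longleftrightarrow>
     (\<exists>f. bij_betw f (verts G) (verts H) \<and>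
          (\<forall>u\<in>verts G. \<forall>v\<in>verts G. {u, v} \<in> edges G \<longleftrightarrow> {f u, f v} \<in> edges H))"

text \<open>As \<open>subgraph\<close> does not ask for an induced subgraph, neither does \<open>T\<close>-freeness.\<close>

definition free_of :: "'a graph \<Rightarrow> 'b graph \<Rightarrow> bool" where
  "free_of T G \<longleftrightarrow> \<not> (\<exists>H. subgraph H G \<and> isomorphic T H)"

definition walk :: "'a graph \<Rightarrow> 'a list \<Rightarrow> bool" where
  "walk G xs \<longleftrightarrow> xs \<noteq> [] \<and> set xs \<subseteq> verts G \<and> successively (\<lambda>u v. {u, v} \<in> edges G) xs"

definition connected_graph :: "'a graph \<Rightarrow> bool" where
  "connected_graph G \<longleftrightarrow> verts G \<noteq> {} \<and>
     (\<forall>u\<in>verts G. \<forall>v\<in>verts G. \<exists>xs. walk G xs \<and> hd xs = u \<and> last xs = v)"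

text \<open>A cycle lists each of its vertices once; the closing edge joins the last to the first.\<close>

definition cycle :: "'a graph \<Rightarrow> 'a list \<Rightarrow> bool" where
  "cycle G xs \<longleftrightarrow> walk G xs \<and> distinct xs \<and> 3 \<le> length xs \<and> {last xs, hd xs} \<in> edges G"

definition tree :: "'a graph \<Rightarrow> bool" where
  "tree G \<longleftrightarrow> simple_graph G \<and> connected_graph G \<and> \<not> (\<exists>xs. cycle G xs)"

text \<open>
  Distance and diameter are meaningful for (finite, nonempty) connected graphs only;
  a walk with \<open>d\<close> edges visits \<open>Suc d\<close> vertices.
\<close>

definition graph_dist :: "'a graph \<Rightarrow> 'a \<Rightarrow> 'a \<Rightarrow> nat" where
  "graph_dist G u v =
     (LEAST d. \<exists>xs. walk G xs \<and> hd xs = u \<and> last xs = v \<and> length xs = Suc d)"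

definition diameter :: "'a graph \<Rightarrow> nat" where
  "diameter G = Max {graph_dist G u v |u v. u \<in> verts G \<and> v \<in> verts G}"

definition star_graph :: "nat \<Rightarrow> nat graph" where
  "star_graph t = ({0..t}, {{0, i} |i. i \<in> {1..t}})"

definition is_star :: "'a graph \<Rightarrow> bool" where
  "is_star G \<longleftrightarrow> (\<exists>t. isomorphic G (star_graph t))"

definition complete_edges :: "'a set \<Rightarrow> 'a set set" where
  "complete_edges C = {e. e \<subseteq> C \<and> card e = 2}"

definition disjoint_union_of_cliques :: "nat \<Rightarrow> 'a graph \<Rightarrow> bool" where
  "disjoint_union_of_cliques m G \<longleftrightarrow>
     (\<exists>P. partition_on (verts G) P \<and> (\<forall>C\<in>P. card C = m) \<and>
          edges G = (\<Union>C\<in>P. complete_edges C))"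

text \<open>
  The type argument is the vertex type of the host graphs: HOL cannot quantify over types
  inside a definition, so ``every graph'' is obtained by leaving \<open>'b\<close> a type variable.
\<close>

definition strong_erdos_sos :: "'b itself \<Rightarrow> 'a graph \<Rightarrow> bool" where
  "strong_erdos_sos TYPE('b) T \<longleftrightarrow>
     (\<forall>n. \<forall>G :: 'b graph.
        simple_graph G \<and> card (verts G) = n \<and> free_of T G \<and>
        real (card (edges G)) = (real (card (verts T)) - 2) / 2 * real n
        \<longrightarrow> disjoint_union_of_cliques (card (verts T) - 1) G)"

end

theory Submission
  imports Defs
begin

text \<open>
  Let \<open>T\<close> have \<open>m\<close> edges. Rooted at a central vertex, \<open>T\<close> has height two; let \<open>s\<close> be the number of
  non-leaf children of the root, \<open>d\<close> its degree and \<open>N = m - d\<close> the number of leaves at depth two.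
  A \<open>T\<close>-free graph with at least \<open>(m - 1) n / 2\<close> edges is treated by induction on \<open>n\<close>, the cases being
  reduced to graphs in which every proper nonempty set \<open>Y\<close> of vertices spans fewer than
  \<open>(m - 1) |Y| / 2\<close> edges; such a graph is connected and has minimum degree at least \<open>m / 2\<close>.
  All embeddings of \<open>T\<close> come from Hall's theorem: choose the images of the root and of its non-leaf
  children and find distinct representatives for the leaves.

  If all degrees are at most \<open>m - 1\<close>, the graph is regular, and it is complete or contains \<open>T\<close>.
  Otherwise let \<open>B \<noteq> {}\<close> be the set of vertices of degree at least \<open>m\<close>. If \<open>N < d\<close>, then \<open>T\<close> embeds
  with its root at any vertex of \<open>B\<close>, provided that the children span as few edges as possible. If
  \<open>d \<le> N\<close>, every vertex can serve as the root as far as its degree is concerned, and each failure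
  means that few neighbours have large degree. A discharging argument turns this into a bound on the
  number of edges meeting the complement of \<open>B\<close>, which contradicts the sparsity of \<open>B\<close>.
\<close>

section \<open>Hall's marriage theorem\<close>

text \<open>By induction on the size of \<open>I\<close> (Halmos and Vaughan): a tight nonempty
  proper subfamily is matched first and the rest avoids its union; if there is none, one choice is
  made arbitrarily.\<close>

lemma hall_marriage:
  assumes "finite I" "\<And>i. i \<in> I \<Longrightarrow> finite (A i)"
    and "\<And>K. K \<subseteq> I \<Longrightarrow> card K \<le> card (\<Union>i\<in>K. A i)"
  shows "\<exists>f. inj_on f I \<and> (\<forall>i\<in>I. f i \<in> A i)"
  using assms
proof (induction "card I" arbitrary: I A rule: less_induct)
  case less
  note fin = less.prems(1) and finA = less.prems(2) and H = less.prems(3)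
  have finU: "finite (\<Union>i\<in>K. A i)" if "K \<subseteq> I" for K
    using that fin finA finite_subset[OF that fin] by auto
  show ?case
  proof (cases "\<exists>K. K \<subset> I \<and> K \<noteq> {} \<and> card (\<Union>i\<in>K. A i) = card K")
    case True
    then obtain K where K: "K \<subset> I" "K \<noteq> {}" and eq: "card (\<Union>i\<in>K. A i) = card K"
      by blast
    define U where "U = (\<Union>i\<in>K. A i)"
    have finK: "finite K" using K fin by (meson finite_subset psubset_imp_subset)
    have "card K < card I" using K fin by (simp add: psubset_card_mono)
    then obtain f where f: "inj_on f K" "\<forall>i\<in>K. f i \<in> A i"
    proof -
      have "i \<in> I" if "i \<in> K" for i using K that by auto
      moreover have "M \<subseteq> I" if "M \<subseteq> K" for M using K that by auto
      ultimately show ?thesis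
        using less.hyps[OF \<open>card K < card I\<close> finK finA H] that by blast
    qed
    have "I - K \<subset> I" using K by auto
    then have "card (I - K) < card I" using fin by (rule psubset_card_mono[rotated])
    \<comment> \<open>Hall's condition for \<open>M \<union> K\<close>, minus the equality for
      \<open>K\<close>.\<close>
    moreover have "card M \<le> card (\<Union>i\<in>M. A i - U)" if M: "M \<subseteq> I - K" for M
    proof -
      have "card M + card K = card (M \<union> K)"
        using M finK fin by (subst card_Un_disjoint) (auto intro: finite_subset)
      also have "\<dots> \<le> card (\<Union>i\<in>M \<union> K. A i)"
        using M K by (intro H) auto
      also have "(\<Union>i\<in>M \<union> K. A i) = (\<Union>i\<in>M. A i - U) \<union> U"
        by (auto simp: U_def)
      also have "card \<dots> \<le> card (\<Union>i\<in>M. A i - U) + card U"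
        by (rule card_Un_le)
      finally show ?thesis using eq by (simp add: U_def)
    qed
    ultimately obtain g where g: "inj_on g (I - K)" "\<forall>i\<in>I - K. g i \<in> A i - U"
      using less.hyps[of "I - K" "\<lambda>i. A i - U"] fin finA by blast
    let ?h = "\<lambda>i. if i \<in> K then f i else g i"
    have "inj_on ?h I"
    proof (rule inj_onI)
      fix i j assume ij: "i \<in> I" "j \<in> I" "?h i = ?h j"
      have fU: "f a \<in> U" if "a \<in> K" for a using f(2) that by (auto simp: U_def)
      have gU: "g a \<notin> U" if "a \<in> I" "a \<notin> K" for a using g(2) that by blast
      consider "i \<in> K" "j \<in> K" | "i \<notin> K" "j \<notin> K"
        using ij fU gU by metis
      then show "i = j"
        using ij inj_onD[OF f(1), of i j] inj_onD[OF g(1), of i j] by cases simp_all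
    qed
    moreover have "\<forall>i\<in>I. ?h i \<in> A i" using f g by auto
    ultimately show ?thesis by blast
  next
    case noncrit: False
    show ?thesis
    proof (cases "I = {}")
      case False
      then obtain i where i: "i \<in> I" by blast
      have "card {i} \<le> card (\<Union>j\<in>{i}. A j)" using i by (intro H) auto
      then have "A i \<noteq> {}" by auto
      then obtain a where a: "a \<in> A i" by blast
      \<comment> \<open>Without tight subfamilies each union has an element to spare, which pays for
        \<open>a\<close>.\<close>
      have "card M \<le> card (\<Union>j\<in>M. A j - {a})" if M: "M \<subseteq> I - {i}" for M
      proof (cases "M = {}")
        case False
        moreover have "M \<subset> I" using M i by auto
        ultimately have "card (\<Union>j\<in>M. A j) \<noteq> card M"
          using noncrit by blast
        then have "card M < card (\<Union>j\<in>M. A j)"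
          using H[of M] \<open>M \<subset> I\<close> by auto
        also have "\<dots> \<le> Suc (card ((\<Union>j\<in>M. A j) - {a}))"
          using diff_card_le_card_Diff[of "{a}" "\<Union>j\<in>M. A j"] by simp
        also have "(\<Union>j\<in>M. A j) - {a} = (\<Union>j\<in>M. A j - {a})" by blast
        finally show ?thesis by simp
      qed simp
      moreover have "card (I - {i}) < card I" by (rule card_Diff1_less[OF fin i])
      ultimately obtain g where g: "inj_on g (I - {i})" "\<forall>j\<in>I - {i}. g j \<in> A j - {a}"
        using less.hyps[of "I - {i}" "\<lambda>j. A j - {a}"] fin finA by blast
      have "inj_on (g(i := a)) I"
        using g by (auto simp: inj_on_def)
      moreover have "\<forall>j\<in>I. (g(i := a)) j \<in> A j" using g a by auto
      ultimately show ?thesis by blast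
    qed simp
  qed
qed

section \<open>Degree sums\<close>

text \<open>With adjacency as a predicate, an induced subgraph is given by its vertex set
  \<open>X\<close> alone; \<open>v\<close> may lie outside \<open>X\<close>.\<close>

definition nbs :: "('b \<Rightarrow> 'b \<Rightarrow> bool) \<Rightarrow> 'b set \<Rightarrow> 'b \<Rightarrow> 'b set" where
  "nbs E X v = {u \<in> X. E v u}"

text \<open>For symmetric irreflexive \<open>E\<close> this is twice the number of edges spanned by
  \<open>X\<close>; the doubling keeps all density bounds in the natural numbers.\<close>

definition degsum :: "('b \<Rightarrow> 'b \<Rightarrow> bool) \<Rightarrow> 'b set \<Rightarrow> nat" where
  "degsum E X = (\<Sum>v\<in>X. card (nbs E X v))"

lemma finite_nbs [simp]: "finite X \<Longrightarrow> finite (nbs E X v)"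
  by (simp add: nbs_def)

lemma nbs_subset: "nbs E X v \<subseteq> X"
  by (auto simp: nbs_def)

lemma mem_nbs [simp]: "u \<in> nbs E X v \<longleftrightarrow> u \<in> X \<and> E v u"
  by (simp add: nbs_def)

lemma card_nbs_Un:
  assumes "finite X" "finite Y" "X \<inter> Y = {}"
  shows "card (nbs E (X \<union> Y) v) = card (nbs E X v) + card (nbs E Y v)"
proof -
  have "nbs E (X \<union> Y) v = nbs E X v \<union> nbs E Y v" by (auto simp: nbs_def)
  then show ?thesis using assms by (simp add: card_Un_disjoint disjoint_iff)
qed

locale sym_irrefl =
  fixes E :: "'b \<Rightarrow> 'b \<Rightarrow> bool"
  assumes sym: "E u v \<Longrightarrow> E v u" and irrefl [simp]: "\<not> E v v"
begin

text \<open>Both sides count the adjacent pairs between \<open>X\<close> and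
  \<open>Y\<close>.\<close>

lemma sum_card_nbs_swap:
  assumes "finite X" "finite Y"
  shows "(\<Sum>v\<in>X. card (nbs E Y v)) = (\<Sum>v\<in>Y. card (nbs E X v))"
proof -
  have *: "card (nbs E Z v) = (\<Sum>u\<in>Z. if E v u then 1 else 0)" if "finite Z" for Z v
    using that by (simp add: nbs_def flip: sum.inter_filter)
  have "(\<Sum>v\<in>X. card (nbs E Y v)) = (\<Sum>v\<in>X. \<Sum>u\<in>Y. if E v u then 1 else 0)"
    using assms by (simp add: *)
  also have "\<dots> = (\<Sum>u\<in>Y. \<Sum>v\<in>X. if E u v then 1 else 0)"
    by (subst sum.swap) (intro sum.cong refl if_cong, blast intro: sym)
  finally show ?thesis using assms by (simp add: *)
qed

lemma degsum_Un:
  assumes "finite X" "finite Y" "X \<inter> Y = {}"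
  shows "degsum E (X \<union> Y) = degsum E X + degsum E Y + 2 * (\<Sum>v\<in>X. card (nbs E Y v))"
  using assms sum_card_nbs_swap[of X Y]
  by (simp add: degsum_def sum.union_disjoint card_nbs_Un sum.distrib)

lemma degsum_insert:
  assumes "finite X" "v \<notin> X"
  shows "degsum E (insert v X) = degsum E X + 2 * card (nbs E X v)"
proof -
  have "degsum E {v} = 0" by (simp add: degsum_def nbs_def)
  then show ?thesis using degsum_Un[of "{v}" X] assms by simp
qed

end

section \<open>Embedding trees of height two\<close>

text \<open>
  The tree with root \<open>r\<close> of height two: \<open>I\<close> consists of the children of \<open>r\<close> that are not
  leaves, \<open>J\<close> of all the leaves other than \<open>r\<close> (at depth one or two), and \<open>p\<close> maps leaves to
  their parents.
\<close>

locale height_two_tree =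
  fixes r :: 'a and I J :: "'a set" and p :: "'a \<Rightarrow> 'a"
  assumes finite_I [simp]: "finite I" and finite_J [simp]: "finite J"
    and r_notin_I: "r \<notin> I" and r_notin_J: "r \<notin> J" and disj: "I \<inter> J = {}"
    and parent: "x \<in> J \<Longrightarrow> p x \<in> insert r I"
    and nonleaf: "c \<in> I \<Longrightarrow> \<exists>x\<in>J. p x = c"
    and I_nonempty: "I \<noteq> {}"
    and root_degree: "2 \<le> card I + card {x \<in> J. p x = r}"
begin

definition embeds :: "('b \<Rightarrow> 'b \<Rightarrow> bool) \<Rightarrow> 'b set \<Rightarrow> bool" where
  "embeds E X \<longleftrightarrow> (\<exists>f. inj_on f (insert r (I \<union> J)) \<and> f ` insert r (I \<union> J) \<subseteq> X \<and>
     (\<forall>c\<in>I. E (f r) (f c)) \<and> (\<forall>x\<in>J. E (f (p x)) (f x)))"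

definition root_leaves :: "'a set" where
  "root_leaves = {x \<in> J. p x = r}"

definition deep_leaves :: "'a set" where
  "deep_leaves = {x \<in> J. p x \<in> I}"

text \<open>The number of edges, one for each vertex other than \<open>r\<close>; so
  \<open>size_T - 1\<close> is the k - 2 of the conjecture.\<close>

definition size_T :: nat where
  "size_T = card I + card J"

lemma finite_leaves [simp]: "finite root_leaves" "finite deep_leaves"
  by (simp_all add: root_leaves_def deep_leaves_def)

lemma card_J: "card J = card root_leaves + card deep_leaves"
proof -
  have "J = root_leaves \<union> deep_leaves"
    using parent by (auto simp: root_leaves_def deep_leaves_def)
  moreover have "root_leaves \<inter> deep_leaves = {}"
    using r_notin_I by (auto simp: root_leaves_def deep_leaves_def)
  ultimately show ?thesis using card_Un_disjoint[OF finite_leaves] by simp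
qed

text \<open>A child in \<open>I\<close> that is no parent of a leaf in \<open>K\<close> has a leaf
  of its own outside \<open>K\<close>, and distinct children have distinct leaves.\<close>

lemma card_deep_leaves_ge:
  assumes "K \<subseteq> deep_leaves"
  shows "card K + card (I - p ` K) \<le> card deep_leaves"
proof -
  obtain q where q: "\<And>c. c \<in> I \<Longrightarrow> q c \<in> J \<and> p (q c) = c"
    using nonleaf by metis
  have "inj_on q (I - p ` K)" using q by (metis Diff_iff inj_on_def)
  then have "card (I - p ` K) = card (q ` (I - p ` K))" by (simp add: card_image)
  moreover have "K \<inter> q ` (I - p ` K) = {}"
  proof -
    have "q c \<notin> K" if "c \<in> I - p ` K" for c
    proof
      assume "q c \<in> K"
      then have "p (q c) \<in> p ` K" by (rule imageI)
      then show False using q[of c] that by simp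
    qed
    then show ?thesis by blast
  qed
  moreover have "finite K" using assms finite_subset finite_leaves(2) by blast
  ultimately have "card K + card (I - p ` K) = card (K \<union> q ` (I - p ` K))"
    by (simp add: card_Un_disjoint)
  also have "\<dots> \<le> card deep_leaves"
    using assms q by (intro card_mono) (auto simp: deep_leaves_def)
  finally show ?thesis .
qed

lemma card_I_pos: "0 < card I"
  using I_nonempty by (simp add: card_gt_0_iff)

lemma card_I_le: "card I \<le> card deep_leaves"
  using card_deep_leaves_ge[of "{}"] by simp

lemma size_T_ge: "3 \<le> size_T" "2 * card I \<le> size_T"
  using root_degree card_I_pos card_I_le card_J by (auto simp: size_T_def root_leaves_def)

lemma embeds_if_hall:
  assumes "finite X" "v \<in> X" "\<And>u. \<not> E u u" "inj_on g I" "g ` I \<subseteq> nbs E X v"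
    and H: "\<And>K. K \<subseteq> J \<Longrightarrow>
      card K \<le> card (\<Union>x\<in>K. nbs E X ((g(r := v)) (p x)) - insert v (g ` I))"
  shows "embeds E X"
proof -
  let ?g = "g(r := v)"
  obtain h where h: "inj_on h J" "\<And>x. x \<in> J \<Longrightarrow> h x \<in> nbs E X (?g (p x)) - insert v (g ` I)"
    using hall_marriage[of J "\<lambda>x. nbs E X (?g (p x)) - insert v (g ` I)"] H assms(1) by auto
  define f where "f x = (if x \<in> J then h x else ?g x)" for x
  have fI: "f c = g c" if "c \<in> I" for c using that disj r_notin_I by (auto simp: f_def)
  have fr: "f r = v" using r_notin_J by (simp add: f_def)
  have fJ: "f x = h x" if "x \<in> J" for x using that by (simp add: f_def)
  have vg: "v \<notin> g ` I" using assms(3,5) by auto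
  have "inj_on f (I \<union> J)"
    unfolding inj_on_Un
  proof (intro conjI)
    show "inj_on f I" using assms(4) fI by (simp cong: inj_on_cong)
    show "inj_on f J" using h(1) fJ by (simp cong: inj_on_cong)
    show "f ` (I - J) \<inter> f ` (J - I) = {}" 
    proof -
      have "f c \<noteq> f x" if "c \<in> I" "x \<in> J" for c x
        using that fI fJ h(2)[of x] by (metis DiffD2 image_eqI insertCI)
      then show ?thesis by blast
    qed
  qed
  moreover have "f r \<notin> f ` (I \<union> J)"
  proof
    assume "f r \<in> f ` (I \<union> J)"
    then obtain x where x: "x \<in> I \<union> J" "v = f x" using fr by auto
    then show False using vg h(2)[of x] fI fJ by (cases "x \<in> J") auto
  qed
  ultimately have "inj_on f (insert r (I \<union> J))"
    using r_notin_I r_notin_J by (subst inj_on_insert) auto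
  moreover have "f ` insert r (I \<union> J) \<subseteq> X"
    using fr fI fJ h(2) assms(2,5) by auto
  moreover have "\<forall>c\<in>I. E (f r) (f c)" using fr fI assms(5) by auto
  moreover have "\<forall>x\<in>J. E (f (p x)) (f x)"
  proof
    fix x assume x: "x \<in> J"
    have "f (p x) = ?g (p x)"
      using parent[OF x] fr fI r_notin_I by auto
    then show "E (f (p x)) (f x)" using h(2)[OF x] fJ[OF x] by simp
  qed
  ultimately show ?thesis unfolding embeds_def by blast
qed

end

section \<open>Embeddings from degree conditions\<close>

locale tree_in_graph = height_two_tree r I J p + sym_irrefl E
  for r :: 'a and I J p and E :: "'b \<Rightarrow> 'b \<Rightarrow> bool"
begin

text \<open>
  Among the sets \<open>C\<close> of \<open>card I\<close> neighbours of \<open>v\<close> take one that spans the fewest edges. A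
  violator of Hall's condition yields a \<open>u \<in> C\<close> and a neighbour \<open>y\<close> of \<open>v\<close> outside \<open>C\<close> whose
  exchange would decrease the number of edges.
\<close>

lemma embeds_if_few_deep_leaves:
  assumes X: "finite X" "v \<in> X" and deg_v: "size_T \<le> card (nbs E X v)"
    and deg: "\<And>u. u \<in> nbs E X v \<Longrightarrow> card deep_leaves < card (nbs E X u)"
  shows "embeds E X"
proof -
  define A where "A = nbs E X v"
  have finA: "finite A" and AX: "A \<subseteq> X" and vA: "v \<notin> A"
    using X by (auto simp: A_def)
  have "card I \<le> card A" using deg_v by (simp add: A_def size_T_def)
  then obtain C0 where "C0 \<subseteq> A" "card C0 = card I" by (meson obtain_subset_with_card_n)
  then obtain C where C: "C \<subseteq> A" "card C = card I"
    and min: "\<And>D. D \<subseteq> A \<Longrightarrow> card D = card I \<Longrightarrow> degsum E C \<le> degsum E D"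
    using ex_has_least_nat[of "\<lambda>C. C \<subseteq> A \<and> card C = card I" C0 "degsum E"] by blast
  have finC: "finite C" using C finA finite_subset by blast
  obtain g where g: "bij_betw g I C"
    using C(2) finC finite_I by (metis finite_same_card_bij)
  then have gI: "g ` I = C" and inj: "inj_on g I" by (auto simp: bij_betw_def)
  show ?thesis
  proof (rule embeds_if_hall[where v = v and g = g])
    show "finite X" "v \<in> X" "\<not> E u u" "inj_on g I" "g ` I \<subseteq> nbs E X v" for u
      using X inj gI C by (auto simp: A_def)
    fix K assume K: "K \<subseteq> J"
    let ?A = "\<lambda>x. nbs E X ((g(r := v)) (p x)) - insert v (g ` I)"
    define Z where "Z = (\<Union>x\<in>K. ?A x)"
    have finK: "finite K" using K finite_J finite_subset by blast
    have finZ: "finite Z" using X finK by (auto simp: Z_def)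
    show "card K \<le> card (\<Union>x\<in>K. ?A x)"
    proof (rule ccontr)
      assume "\<not> ?thesis"
      then have small: "card Z < card K" by (simp add: Z_def)
      \<comment> \<open>A root leaf alone would offer \<open>A - C\<close>, which has at least
        \<open>card J\<close> elements; so a violator consists of deep leaves.\<close>
      have "p x \<noteq> r" if x: "x \<in> K" for x
      proof
        assume "p x = r"
        then have "?A x = A - C" using vA gI by (auto simp: A_def)
        then have "A - C \<subseteq> Z" using x unfolding Z_def by blast
        then have "card (A - C) \<le> card Z" using finZ by (simp add: card_mono)
        moreover have "card (A - C) = card A - card I" using C finC by (simp add: card_Diff_subset)
        moreover have "card K \<le> card J" using K by (simp add: card_mono)
        ultimately show False using deg_v small by (simp add: A_def size_T_def)
      qed
      then have pK: "p x \<in> I" "p x \<noteq> r" if "x \<in> K" for x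
        using that K parent by blast+
      then have Kdeep: "K \<subseteq> deep_leaves" using K by (auto simp: deep_leaves_def)
      define U where "U = g ` p ` K"
      have UC: "U \<subseteq> C" using pK gI by (auto simp: U_def)
      have NU: "nbs E X u - insert v C \<subseteq> Z" if "u \<in> U" for u
        using that pK gI unfolding U_def Z_def by fastforce
      have "C - U = g ` (I - p ` K)"
        using inj_on_image_set_diff[OF inj, of I "p ` K"] pK gI by (auto simp: U_def)
      then have "card (C - U) = card (I - p ` K)"
        using inj by (metis Diff_subset card_image inj_on_subset)
      then have count: "card Z + card (C - U) < card deep_leaves"
        using card_deep_leaves_ge[OF Kdeep] small by simp
      \<comment> \<open>Room for the exchange: some neighbour \<open>y\<close> of \<open>v\<close>
        lies outside \<open>C\<close> and \<open>Z\<close>.\<close>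
      have "card C + card Z < card A"
        using count deg_v C(2) by (simp add: A_def size_T_def card_J)
      then have "\<not> A \<subseteq> C \<union> Z"
        using card_mono[of "C \<union> Z" A] card_Un_le[of C Z] finC finZ by fastforce
      then obtain y where y: "y \<in> A" "y \<notin> C" "y \<notin> Z" by blast
      obtain x0 where "x0 \<in> K" using small by fastforce
      then obtain u where u: "u \<in> U" by (auto simp: U_def)
      have "nbs E C y \<subseteq> C - U"
      proof
        fix w assume w: "w \<in> nbs E C y"
        have "w \<notin> U"
        proof
          assume "w \<in> U"
          then have "nbs E X w - insert v C \<subseteq> Z" by (rule NU)
          moreover have "y \<in> nbs E X w - insert v C"
            using w y AX vA sym[of y w] by auto
          ultimately have "y \<in> Z" by blast
          then show False using y by simp
        qed
        then show "w \<in> C - U" using w by simp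
      qed
      then have ny: "card (nbs E C y) \<le> card (C - U)" using finC by (simp add: card_mono)
      \<comment> \<open>Since \<open>Z\<close> is small and \<open>u\<close> has more than
        \<open>card deep_leaves\<close> neighbours, \<open>u\<close> must have more neighbours in
        \<open>C\<close> than \<open>y\<close> has.\<close>
      have "nbs E X u \<subseteq> insert v (nbs E C u \<union> Z)" using NU[OF u] by auto
      then have "card (nbs E X u) \<le> card (insert v (nbs E C u \<union> Z))"
        using finC finZ by (intro card_mono) auto
      also have "\<dots> \<le> Suc (card (nbs E C u) + card Z)"
        using card_Un_le[of "nbs E C u" Z] finC finZ by (simp add: card_insert_if)
      finally have "card (nbs E C y) < card (nbs E C u)"
        using deg[of u] u UC C(1) count ny unfolding A_def by auto
      moreover have "nbs E (C - {u}) u = nbs E C u" by auto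
      moreover have "card (nbs E (C - {u}) y) \<le> card (nbs E C y)"
        using finC by (intro card_mono) auto
      moreover have "insert u (C - {u}) = C" using u UC by auto
      ultimately have "degsum E (insert y (C - {u})) < degsum E C"
        using degsum_insert[of "C - {u}" y] degsum_insert[of "C - {u}" u] finC y by simp
      moreover have "card (insert y (C - {u})) = card I"
        using finC y u UC C(2) card_Suc_Diff1[of C u] by auto
      moreover have "insert y (C - {u}) \<subseteq> A" using y C by auto
      ultimately show False using min by (meson not_le)
    qed
  qed
qed

text \<open>With the children ordered by \<open>h\<close>, the one with index \<open>i\<close> needs
  a degree that leaves room only for the root leaves and the leaves below indices up to
  \<open>i\<close>. Hall's theorem places first the children, then the leaves.\<close>

lemma embeds_if_enough_large_nbs:
  assumes X: "finite X" "v \<in> X" and h: "bij_betw h {..<card I} I"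
    and deg_v: "card I + card root_leaves \<le> card (nbs E X v)"
    and large: "\<And>i. i < card I \<Longrightarrow> card I - i \<le> card {u \<in> nbs E X v.
      card I + card root_leaves + card {x \<in> J. p x \<in> h ` {..i}} \<le> card (nbs E X u)}"
  shows "embeds E X"
proof -
  define s where "s = card I"
  define t where "t i = card I + card root_leaves + card {x \<in> J. p x \<in> h ` {..i}}" for i
  have "\<exists>\<phi>. inj_on \<phi> {..<s} \<and> (\<forall>i\<in>{..<s}. \<phi> i \<in> {u \<in> nbs E X v. t i \<le> card (nbs E X u)})"
  proof (rule hall_marriage)
    fix K assume K: "K \<subseteq> {..<s}"
    show "card K \<le> card (\<Union>i\<in>K. {u \<in> nbs E X v. t i \<le> card (nbs E X u)})"
    proof (cases "K = {}")
      case False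
      have finK: "finite K" using K finite_subset by blast
      \<comment> \<open>The smallest index suffices: its set alone has at least \<open>s - i\<close>
        elements.\<close>
      define i where "i = Min K"
      have i: "i \<in> K" "K \<subseteq> {i..<s}" using False K finK by (auto simp: i_def)
      have "card K \<le> s - i" using card_mono[OF _ i(2)] by simp
      also have "\<dots> \<le> card {u \<in> nbs E X v. t i \<le> card (nbs E X u)}"
        using large[of i] i K by (auto simp: s_def t_def)
      also have "\<dots> \<le> card (\<Union>i\<in>K. {u \<in> nbs E X v. t i \<le> card (nbs E X u)})"
        using i(1) finK X(1) by (intro card_mono) (auto simp: nbs_def)
      finally show ?thesis .
    qed simp
  qed (use X in auto)
  then obtain \<phi> where \<phi>: "inj_on \<phi> {..<s}"
    "\<And>i. i < s \<Longrightarrow> \<phi> i \<in> nbs E X v" "\<And>i. i < s \<Longrightarrow> t i \<le> card (nbs E X (\<phi> i))"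
    by auto
  define k where "k = inv_into {..<s} h"
  have k: "bij_betw k I {..<s}" and hk: "\<And>c. c \<in> I \<Longrightarrow> h (k c) = c"
    using h by (auto simp: k_def s_def bij_betw_inv_into bij_betw_inv_into_right)
  define g where "g = \<phi> \<circ> k"
  have inj: "inj_on g I" and gA: "g ` I \<subseteq> nbs E X v"
  proof -
    show "inj_on g I"
      using k \<phi>(1) by (simp add: g_def bij_betw_def comp_inj_on)
    have "k c < s" if "c \<in> I" for c using k that by (auto simp: bij_betw_def)
    then show "g ` I \<subseteq> nbs E X v" using \<phi>(2) by (fastforce simp: g_def)
  qed
  define C where "C = g ` I"
  have finC: "finite C" and cardC: "card C = s" by (auto simp: C_def s_def card_image inj)
  show ?thesis
  proof (rule embeds_if_hall[where v = v and g = g])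
    show "finite X" "v \<in> X" "\<not> E u u" "inj_on g I" "g ` I \<subseteq> nbs E X v" for u
      using X inj gA by auto
    fix K assume K: "K \<subseteq> J"
    let ?A = "\<lambda>x. nbs E X ((g(r := v)) (p x)) - insert v (g ` I)"
    have finK: "finite K" using K finite_J finite_subset by blast
    have finU: "finite (\<Union>x\<in>K. ?A x)" using X finK by auto
    define M where "M = {i. i < s \<and> h i \<in> p ` K}"
    show "card K \<le> card (\<Union>x\<in>K. ?A x)"
    proof (cases "M = {}")
      case True
      have pr: "p x = r" if x: "x \<in> K" for x
      proof (rule ccontr)
        assume "p x \<noteq> r"
        then have "p x \<in> I" using x K parent by blast
        then have "k (p x) \<in> M" using x k hk by (auto simp: M_def bij_betw_def)
        then show False using True by simp
      qed
      show ?thesis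
      proof (cases "K = {}")
        case False
        then obtain x where x: "x \<in> K" by blast
        have "card K \<le> card root_leaves"
          using pr K by (intro card_mono) (auto simp: root_leaves_def)
        also have "\<dots> \<le> card (nbs E X v) - card C" using deg_v cardC by (simp add: s_def)
        also have "\<dots> \<le> card (nbs E X v - C)" by (rule diff_card_le_card_Diff[OF finC])
        also have "nbs E X v - C = ?A x" using pr[OF x] by (auto simp: C_def)
        also have "card (?A x) \<le> card (\<Union>x\<in>K. ?A x)" using x by (intro card_mono finU) blast
        finally show ?thesis .
      qed simp
    next
      case False
      \<comment> \<open>By the choice of the largest index, \<open>K\<close> has only root leaves
        and leaves below \<open>h 0\<close>, ..., \<open>h i\<close>: at most \<open>t i - s\<close>
        elements.\<close>
      define i where "i = Max M"
      have finM: "finite M" by (simp add: M_def)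
      have i: "i \<in> M" "\<And>j. j \<in> M \<Longrightarrow> j \<le> i" using False finM by (auto simp: i_def)
      then obtain x where x: "x \<in> K" "p x = h i" and i_less: "i < s" by (auto simp: M_def)
      have hi: "h i \<in> I" using i_less h by (auto simp: s_def bij_betw_def)
      then have kh: "k (h i) = i"
        using i_less h by (simp add: k_def s_def bij_betw_def)
      then have ghi: "g (h i) = \<phi> i" by (simp add: g_def)
      have px: "p x \<noteq> r" using x hi r_notin_I by auto
      have "K \<subseteq> root_leaves \<union> {x \<in> J. p x \<in> h ` {..i}}"
      proof
        fix z assume z: "z \<in> K"
        show "z \<in> root_leaves \<union> {x \<in> J. p x \<in> h ` {..i}}"
        proof (cases "p z = r")
          case False
          then have pz: "p z \<in> I" using z K parent by blast
          then have "k (p z) \<in> M" using z k hk by (auto simp: M_def bij_betw_def)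
          then have "k (p z) \<le> i" by (rule i(2))
          then have "h (k (p z)) \<in> h ` {..i}" by blast
          then show ?thesis using hk[OF pz] z K by auto
        qed (use z K in \<open>auto simp: root_leaves_def\<close>)
      qed
      then have "card K \<le> card (root_leaves \<union> {x \<in> J. p x \<in> h ` {..i}})"
        by (intro card_mono) auto
      also have "\<dots> \<le> card root_leaves + card {x \<in> J. p x \<in> h ` {..i}}" by (rule card_Un_le)
      also have "\<dots> \<le> t i - s" by (simp add: t_def s_def)
      \<comment> \<open>Of the \<open>s + 1\<close> vertices in use, \<open>\<phi> i\<close> is not
        its own neighbour, so at most \<open>s\<close> are lost.\<close>
      also have "\<dots> \<le> card (nbs E X (\<phi> i)) - card (insert v (C - {\<phi> i}))"
      proof -
        have "\<phi> i \<in> C" unfolding C_def using ghi hi by (metis image_eqI)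
        then have "card (insert v (C - {\<phi> i})) \<le> s"
          using cardC finC card_Suc_Diff1[of C "\<phi> i"] by (simp add: card_insert_if)
        then show ?thesis using \<phi>(3)[OF i_less] by simp
      qed
      also have "\<dots> \<le> card (nbs E X (\<phi> i) - insert v (C - {\<phi> i}))"
        using finC by (intro diff_card_le_card_Diff) auto
      also have "nbs E X (\<phi> i) - insert v (C - {\<phi> i}) = ?A x"
        using px x ghi by (auto simp: C_def)
      also have "card (?A x) \<le> card (\<Union>x\<in>K. ?A x)" using x by (intro card_mono finU) blast
      finally show ?thesis .
    qed
  qed
qed

text \<open>The preceding criterion fails at some index \<open>i\<close>; \<open>\<theta>\<close> is
  the threshold there and \<open>c\<close> is \<open>card I - Suc i\<close>. The children after
  \<open>i\<close> own leaves outside \<open>S i\<close>, which bounds \<open>\<theta> + c\<close>;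
  the bound on \<open>c\<close> comes from \<open>2 * card I \<le> size_T\<close>.\<close>

lemma few_large_nbs_if_not_embeds:
  assumes "finite X" "v \<in> X" "\<not> embeds E X"
    and "card I + card root_leaves \<le> card (nbs E X v)"
  shows "\<exists>\<theta> c. \<theta> + c \<le> size_T \<and> 2 * c < size_T \<and>
    card {u \<in> nbs E X v. \<theta> \<le> card (nbs E X u)} \<le> c"
proof -
  obtain h where h: "bij_betw h {..<card I} I"
    using ex_bij_betw_nat_finite[OF finite_I] by (auto simp: lessThan_atLeast0)
  define S where "S i = {x \<in> J. p x \<in> h ` {..i}}" for i
  have "\<exists>i<card I. card {u \<in> nbs E X v.
      card I + card root_leaves + card (S i) \<le> card (nbs E X u)} < card I - i"
  proof (rule ccontr)
    assume "\<not> ?thesis"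
    then have "card I - i \<le> card {u \<in> nbs E X v.
      card I + card root_leaves + card (S i) \<le> card (nbs E X u)}" if "i < card I" for i
      using that not_le by blast
    then show False
      using embeds_if_enough_large_nbs[OF assms(1,2) h assms(4)] assms(3) by (simp add: S_def)
  qed
  then obtain i where i: "i < card I" and few: "card {u \<in> nbs E X v.
      card I + card root_leaves + card (S i) \<le> card (nbs E X u)} < card I - i"
    by blast
  have hI: "h ` {..i} \<subseteq> I"
    using i bij_betw_imp_surj_on[OF h] by fastforce
  have pS: "p ` S i = h ` {..i}"
  proof
    show "p ` S i \<subseteq> h ` {..i}" unfolding S_def by blast
    show "h ` {..i} \<subseteq> p ` S i"
    proof
      fix c assume c: "c \<in> h ` {..i}"
      then obtain x where "x \<in> J" "p x = c" using nonleaf hI by blast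
      then show "c \<in> p ` S i" using c unfolding S_def by blast
    qed
  qed
  have "card (h ` {..i}) = Suc i"
  proof -
    have "inj_on h {..i}"
      using i by (auto intro!: inj_on_subset[OF bij_betw_imp_inj_on[OF h]])
    then show ?thesis by (simp add: card_image)
  qed
  then have "card (I - p ` S i) = card I - Suc i"
    using hI pS by (simp add: card_Diff_subset finite_subset)
  moreover have "S i \<subseteq> deep_leaves" using hI by (auto simp: S_def deep_leaves_def)
  ultimately have "card (S i) + (card I - Suc i) \<le> card deep_leaves"
    using card_deep_leaves_ge[of "S i"] by simp
  moreover have "size_T = card I + card root_leaves + card deep_leaves"
    by (simp add: size_T_def card_J)
  moreover note size_T_ge i
  ultimately have "card I + card root_leaves + card (S i) + (card I - Suc i) \<le> size_T"
    "2 * (card I - Suc i) < size_T"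
    by linarith+
  moreover have "card {u \<in> nbs E X v. card I + card root_leaves + card (S i) \<le> card (nbs E X u)}
      \<le> card I - Suc i"
    using few by linarith
  ultimately show ?thesis by blast
qed

end

section \<open>Discharging\<close>

text \<open>The claim says that \<open>\<alpha> / a + \<beta> / b\<close> is at least 2. The last
  two hypotheses bound the summands below by \<open>2 * \<alpha> / (\<alpha> + \<beta>)\<close> and
  \<open>2 * \<beta> / (\<alpha> + \<beta>)\<close>.\<close>

lemma charge_bound:
  fixes a b \<alpha> \<beta> :: real
  assumes "0 < a" "0 < b" "0 \<le> \<alpha>" "0 \<le> \<beta>" "2 * a \<le> \<alpha> + \<beta>" "2 * b \<le> \<alpha> + \<beta>"
  shows "(a - \<alpha>) / a \<le> (\<beta> - b) / b"
proof -
  have "b * \<alpha> * (2 * a) \<le> b * \<alpha> * (\<alpha> + \<beta>)" "a * \<beta> * (2 * b) \<le> a * \<beta> * (\<alpha> + \<beta>)"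
    using assms by (intro mult_left_mono; simp)+
  then have "(\<alpha> + \<beta>) * (2 * (a * b)) \<le> (\<alpha> + \<beta>) * (b * \<alpha> + a * \<beta>)"
    by (simp add: algebra_simps)
  moreover have "0 < \<alpha> + \<beta>" using assms by linarith
  ultimately have "2 * (a * b) \<le> b * \<alpha> + a * \<beta>"
    by (simp only: mult_le_cancel_left_pos)
  then show ?thesis using assms by (simp add: divide_simps algebra_simps)
qed

context sym_irrefl
begin

text \<open>
  Discharging: the vertices of degree at least \<open>m\<close> send charge 1 along each edge to \<open>L\<close>. A vertex
  \<open>w \<in> L\<close> of degree at least \<open>\<theta> w\<close> passes its surplus on, in equal parts of at most
  \<open>\<rho> w \<le> 1\<close>, to its neighbours of degree below \<open>\<theta> w\<close>; afterwards no charge exceeds \<open>m - 1\<close>.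
\<close>

lemma discharging:
  fixes \<theta> c :: "'b \<Rightarrow> nat"
  assumes fin: "finite X"
    and sum_le: "\<And>w. w \<in> X \<Longrightarrow> \<theta> w + c w \<le> m"
    and c_less: "\<And>w. w \<in> X \<Longrightarrow> 2 * c w < m"
    and few: "\<And>w. w \<in> X \<Longrightarrow> card {u \<in> nbs E X w. \<theta> w \<le> card (nbs E X u)} \<le> c w"
    and deg_ge: "\<And>w. w \<in> X \<Longrightarrow> m \<le> 2 * card (nbs E X w)"
  defines "L \<equiv> {v \<in> X. card (nbs E X v) < m}" and "B \<equiv> {v \<in> X. m \<le> card (nbs E X v)}"
  shows "(\<Sum>w\<in>L. card (nbs E X w) + card (nbs E B w)) \<le> (m - 1) * card L"
proof -
  define D where "D w = real (card (nbs E X w))" for w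
  \<comment> \<open>The final charge allowed at a vertex of \<open>L\<close>.\<close>
  define e where "e = real m - 1"
  \<comment> \<open>At most \<open>c w\<close> large neighbours send at most 1 each, so the surplus
    is at most \<open>D w + c w - e\<close>, shared by at least \<open>D w - c w\<close> small
    neighbours.\<close>
  define \<rho> where "\<rho> w = (if real (\<theta> w) \<le> D w then max 0 ((D w + c w - e) / (D w - c w)) else 0)" for w
  \<comment> \<open>\<open>\<phi> w u\<close> is what \<open>w\<close> in \<open>L\<close> passes to
    \<open>u\<close>; \<open>\<psi> u w\<close> is what \<open>u\<close> receives from its neighbour
    \<open>w\<close>.\<close>
  define \<phi> where "\<phi> w u = (if E w u \<and> D u < real (\<theta> w) then \<rho> w else 0)" for w u
  define \<psi> where "\<psi> u w = (if w \<in> B then 1 else if D u < real (\<theta> w) then \<rho> w else 0)" for u w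
  have LX: "L \<subseteq> X" and BX: "B \<subseteq> X" and finL: "finite L" and finB: "finite B"
    and XLB: "X = L \<union> B" and LB: "L \<inter> B = {}"
    using fin by (auto simp: L_def B_def)
  have LD: "D w \<le> e" if "w \<in> L" for w using that by (auto simp: L_def D_def e_def)
  have ce: "2 * real (c w) \<le> e" and te: "real (\<theta> w) + real (c w) \<le> e + 1"
    and cD: "real (c w) < D w" and eD: "e + 1 \<le> 2 * D w" if "w \<in> X" for w
  proof -
    have "2 * c w + 1 \<le> m" using c_less[OF that] by simp
    then have "real (2 * c w + 1) \<le> real m" by (simp only: of_nat_le_iff)
    then show 1: "2 * real (c w) \<le> e" by (simp add: e_def)
    have "real (\<theta> w + c w) \<le> real m" using sum_le[OF that] by (simp only: of_nat_le_iff)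
    then show "real (\<theta> w) + real (c w) \<le> e + 1" by (simp add: e_def)
    have "real m \<le> real (2 * card (nbs E X w))" using deg_ge[OF that] by (simp only: of_nat_le_iff)
    then show 2: "e + 1 \<le> 2 * D w" by (simp add: e_def D_def)
    show "real (c w) < D w" using 1 2 by linarith
  qed
  have e0: "0 \<le> e" if "w \<in> X" for w using ce[OF that] by linarith
  have \<rho>0: "0 \<le> \<rho> w" for w by (simp add: \<rho>_def)
  have \<rho>1: "\<rho> w \<le> 1" if "w \<in> X" for w
    using ce[OF that] cD[OF that] by (simp add: \<rho>_def divide_simps)
  have \<psi>1: "\<psi> u w \<le> 1" if "w \<in> X" for u w
    using \<rho>1[OF that] by (simp add: \<psi>_def)
  have charge: "D u + (\<Sum>w\<in>nbs E X u. \<psi> u w) - (\<Sum>w\<in>L. \<phi> u w) \<le> e" if u: "u \<in> L" for u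
  proof -
    have uX: "u \<in> X" using u LX by auto
    define H where "H = {w \<in> nbs E X u. \<theta> u \<le> card (nbs E X w)}"
    define R where "R = {w \<in> nbs E X u. card (nbs E X w) < \<theta> u}"
    have HR: "nbs E X u = H \<union> R" "H \<inter> R = {}" and finH: "finite H" and finR: "finite R"
      and HX: "H \<subseteq> X" and RX: "R \<subseteq> X"
      using fin by (auto simp: H_def R_def)
    have cH: "real (card H) \<le> c u" using few[OF uX] by (simp add: H_def)
    have "card (nbs E X u) = card H + card R"
      using HR finH finR by (simp add: card_Un_disjoint)
    then have cR: "real (card R) = D u - card H" by (simp add: D_def)
    have RL: "R \<subseteq> L" using sum_le[OF uX] by (auto simp: R_def L_def)
    have in_le: "(\<Sum>w\<in>nbs E X u. \<psi> u w) \<le> card H + (\<Sum>w\<in>R. \<psi> u w)"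
    proof -
      have "(\<Sum>w\<in>nbs E X u. \<psi> u w) = (\<Sum>w\<in>H. \<psi> u w) + (\<Sum>w\<in>R. \<psi> u w)"
        unfolding HR(1) using HR(2) finH finR by (rule sum.union_disjoint[rotated 2])
      moreover have "(\<Sum>w\<in>H. \<psi> u w) \<le> (\<Sum>w\<in>H. 1)"
        using HX by (intro sum_mono \<psi>1) auto
      ultimately show ?thesis by simp
    qed
    have out: "(\<Sum>w\<in>L. \<phi> u w) = \<rho> u * card R"
    proof -
      have "(\<Sum>w\<in>L. \<phi> u w) = (\<Sum>w\<in>R. \<rho> u)"
        using RL LX finL by (intro sum.mono_neutral_cong_right) (auto simp: \<phi>_def R_def D_def)
      then show ?thesis by simp
    qed
    show ?thesis
    proof (cases "real (\<theta> u) \<le> D u")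
      case True
      \<comment> \<open>A sender \<open>w\<close> would satisfy
        \<open>D u < \<theta> w \<le> D w\<close>, against
        \<open>D w < \<theta> u \<le> D u\<close>.\<close>
      have "\<psi> u w = 0" if "w \<in> R" for w
        using that RL LB True by (auto simp: \<psi>_def \<rho>_def R_def D_def)
      then have "(\<Sum>w\<in>R. \<psi> u w) = 0" by simp
      moreover have "D u + c u - e \<le> \<rho> u * card R"
      proof -
        have "D u + c u - e = (D u + c u - e) / (D u - c u) * (D u - c u)"
          using cD[OF uX] by simp
        also have "\<dots> \<le> \<rho> u * (D u - c u)"
          using True cD[OF uX] by (intro mult_right_mono) (auto simp: \<rho>_def)
        also have "\<dots> \<le> \<rho> u * card R"
          using cR cH \<rho>0 by (intro mult_left_mono) auto
        finally show ?thesis .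
      qed
      ultimately show ?thesis using in_le cH out by linarith
    next
      case False
      \<comment> \<open>Here \<open>u\<close> passes nothing on. If \<open>c u\<close> neighbours
        send 1 each, \<open>\<sigma>\<close> is the share of the remaining capacity for each of the
        other \<open>D u - c u\<close> neighbours.\<close>
      define \<sigma> where "\<sigma> = (e - D u - c u) / (D u - c u)"
      have Du: "D u + 1 \<le> real (\<theta> u)" using False by (simp add: D_def)
      have \<sigma>0: "0 \<le> \<sigma>" using Du te[OF uX] cD[OF uX] by (simp add: \<sigma>_def)
      have \<sigma>1: "\<sigma> \<le> 1" using cD[OF uX] eD[OF uX] by (simp add: \<sigma>_def divide_simps)
      have "\<psi> u w \<le> \<sigma>" if w: "w \<in> R" for w
      proof -
        have wB: "w \<notin> B" and wX: "w \<in> X" using w RL LB RX by auto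
        have Dw: "D w + 1 \<le> real (\<theta> u)" using w by (simp add: R_def D_def)
        show ?thesis
        proof (cases "D u < real (\<theta> w) \<and> real (\<theta> w) \<le> D w")
          case True
          \<comment> \<open>Integrality gains the 1 that cancels the one in \<open>te\<close>. Then
            \<open>charge_bound\<close> applies with \<open>a = D w - c w\<close>,
            \<open>\<alpha> = e - 2 * c w\<close>, \<open>b = D u - c u\<close>,
            \<open>\<beta> = e - 2 * c u\<close>.\<close>
          then have "D u + 1 \<le> real (\<theta> w)" by (simp add: D_def)
          then have "D w + real (c u) \<le> e" "D u + real (c w) \<le> e"
            using te[OF wX] te[OF uX] Dw by linarith+
          then have "(D w - c w - (e - 2 * real (c w))) / (D w - c w)
              \<le> ((e - 2 * real (c u)) - (D u - c u)) / (D u - c u)"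
            using ce[OF wX] ce[OF uX] cD[OF wX] cD[OF uX]
            by (intro charge_bound) (simp_all add: algebra_simps)
          then have "(D w + c w - e) / (D w - c w) \<le> \<sigma>"
            by (simp add: \<sigma>_def algebra_simps)
          then show ?thesis using \<sigma>0 wB True by (simp add: \<psi>_def \<rho>_def)
        next
          case False
          then show ?thesis using \<sigma>0 wB by (auto simp: \<psi>_def \<rho>_def)
        qed
      qed
      then have "(\<Sum>w\<in>R. \<psi> u w) \<le> card R * \<sigma>"
        by (rule sum_bounded_above)
      also have "\<dots> = (D u - c u) * \<sigma> + (real (c u) - real (card H)) * \<sigma>"
        unfolding cR by (simp add: algebra_simps)
      \<comment> \<open>If \<open>H\<close> has fewer than \<open>c u\<close> elements, the missing
        ones are replaced by neighbours in \<open>R\<close>, counted with 1 instead of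
        \<open>\<sigma>\<close>.\<close>
      also have "\<dots> \<le> (D u - c u) * \<sigma> + (real (c u) - real (card H)) * 1"
        using cH \<sigma>1 by (intro add_left_mono mult_left_mono) auto
      also have "(D u - c u) * \<sigma> = e - D u - c u"
        using cD[OF uX] by (simp add: \<sigma>_def)
      finally have "(\<Sum>w\<in>R. \<psi> u w) \<le> e - D u - card H" by simp
      moreover have "0 \<le> (\<Sum>w\<in>L. \<phi> u w)"
        using \<rho>0 by (intro sum_nonneg) (simp add: \<phi>_def)
      ultimately show ?thesis using in_le by linarith
    qed
  qed
  have inflow: "(\<Sum>w\<in>nbs E X u. \<psi> u w) = card (nbs E B u) + (\<Sum>w\<in>L. \<phi> w u)" if "u \<in> L" for u
  proof -
    have "nbs E X u = nbs E B u \<union> nbs E L u" "nbs E B u \<inter> nbs E L u = {}"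
      using XLB LB by (auto simp: nbs_def)
    then have "(\<Sum>w\<in>nbs E X u. \<psi> u w) = (\<Sum>w\<in>nbs E B u. \<psi> u w) + (\<Sum>w\<in>nbs E L u. \<psi> u w)"
      using finL finB by (simp add: sum.union_disjoint)
    moreover have "(\<Sum>w\<in>nbs E B u. \<psi> u w) = (\<Sum>w\<in>nbs E B u. 1)"
      by (intro sum.cong) (auto simp: \<psi>_def)
    moreover have "(\<Sum>w\<in>nbs E L u. \<psi> u w) = (\<Sum>w\<in>L. \<phi> w u)"
      using finL LB sym by (intro sum.mono_neutral_cong_left) (auto simp: \<psi>_def \<phi>_def)
    ultimately show ?thesis by simp
  qed
  \<comment> \<open>Charge moved within \<open>L\<close> cancels in the total.\<close>
  have "(\<Sum>u\<in>L. D u + card (nbs E B u))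
      = (\<Sum>u\<in>L. D u + card (nbs E B u)) + (\<Sum>u\<in>L. \<Sum>w\<in>L. \<phi> w u) - (\<Sum>u\<in>L. \<Sum>w\<in>L. \<phi> u w)"
    using sum.swap[of \<phi> L L] by simp
  also have "\<dots> = (\<Sum>u\<in>L. D u + (\<Sum>w\<in>nbs E X u. \<psi> u w) - (\<Sum>w\<in>L. \<phi> u w))"
    by (simp add: inflow sum.distrib sum_subtractf)
  also have "\<dots> \<le> (\<Sum>u\<in>L. e)" by (rule sum_mono[OF charge])
  finally have le: "(\<Sum>u\<in>L. D u + card (nbs E B u)) \<le> e * card L"
    by (simp add: mult.commute)
  show ?thesis
  proof (cases "L = {}")
    case False
    then have "m \<noteq> 0" by (auto simp: L_def)
    then have "e = real (m - 1)" by (simp add: e_def)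
    then have "real (\<Sum>u\<in>L. card (nbs E X u) + card (nbs E B u)) \<le> real ((m - 1) * card L)"
      using le by (simp add: D_def)
    then show ?thesis by (simp only: of_nat_le_iff)
  qed simp
qed

end

section \<open>Dense graphs with sparse proper subgraphs\<close>

context tree_in_graph
begin

text \<open>With the root at \<open>v\<close>, each leaf has at least \<open>card J - 1\<close>
  candidates, so Hall's condition can fail only for \<open>J\<close> itself and with equal candidate
  sets. Putting one child at \<open>u\<close>, and a second, if there is one, at a non-neighbour
  \<open>y\<close> of \<open>u\<close>, excludes this.\<close>

lemma embeds_if_regular:
  assumes X: "finite X" "v \<in> X" and reg: "\<And>w. w \<in> X \<Longrightarrow> card (nbs E X w) = size_T - 1"
    and u: "u \<in> nbs E X v" and z: "z \<in> nbs E X u" "z \<notin> nbs E X v" "z \<noteq> v"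
  shows "embeds E X"
proof -
  define A where "A = nbs E X v"
  define s where "s = card I"
  have finA: "finite A" and AX: "A \<subseteq> X" and vA: "v \<notin> A" and uX: "u \<in> X"
    using X u by (auto simp: A_def)
  have m: "size_T = s + card root_leaves + card deep_leaves" "s \<le> card deep_leaves" "0 < s"
    using card_I_le card_I_pos by (auto simp: s_def size_T_def card_J)
  have cA: "card A = size_T - 1" using reg X by (simp add: A_def)
  \<comment> \<open>Otherwise \<open>v\<close>, \<open>z\<close> and the rest of \<open>A\<close>
    would be \<open>size_T\<close> neighbours of \<open>u\<close>.\<close>
  have "\<not> A - {u} \<subseteq> nbs E X u"
  proof
    assume "A - {u} \<subseteq> nbs E X u"
    moreover have "v \<in> nbs E X u" using u X sym by auto
    ultimately have "insert v (insert z (A - {u})) \<subseteq> nbs E X u" using z by auto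
    then have "card (insert v (insert z (A - {u}))) \<le> size_T - 1"
      using reg[OF uX] X by (metis card_mono finite_nbs)
    moreover have "card (insert v (insert z (A - {u}))) = Suc (card A)"
      using vA z finA u card_Suc_Diff1[of A u] by (simp add: A_def)
    ultimately show False using cA by simp
  qed
  then obtain y where y: "y \<in> A" "y \<noteq> u" "y \<notin> nbs E X u" by blast
  \<comment> \<open>If \<open>I\<close> has a single element, there is no room for \<open>y\<close>,
    but then the root has a leaf and \<open>z\<close> gives the contradiction.\<close>
  define Q where "Q = (if 2 \<le> s then {u, y} else {u})"
  have "Q \<subseteq> A" "card Q \<le> s" using y u m(3) by (auto simp: Q_def A_def)
  moreover have "s \<le> card A" using m cA by simp
  ultimately obtain C where C: "Q \<subseteq> C" "C \<subseteq> A" "card C = s"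
    using exists_subset_between finA by metis
  have finC: "finite C" and uC: "u \<in> C" using C finA finite_subset by (auto simp: Q_def split: if_splits)
  obtain g where g: "bij_betw g I C"
    using C(3) finC finite_I by (metis finite_same_card_bij s_def)
  then have gI: "g ` I = C" and inj: "inj_on g I" by (auto simp: bij_betw_def)
  show ?thesis
  proof (rule embeds_if_hall[where v = v and g = g])
    show "finite X" "v \<in> X" "\<not> E w w" "inj_on g I" "g ` I \<subseteq> nbs E X v" for w
      using X inj gI C by (auto simp: A_def)
    fix K assume K: "K \<subseteq> J"
    let ?A = "\<lambda>x. nbs E X ((g(r := v)) (p x)) - insert v (g ` I)"
    define Z where "Z = (\<Union>x\<in>K. ?A x)"
    have finK: "finite K" using K finite_J finite_subset by blast
    have finZ: "finite Z" using X finK by (auto simp: Z_def)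
    have rootA: "?A x = A - C" if "p x = r" for x
      using that vA gI by (auto simp: A_def)
    have leafA: "?A x = nbs E X (g (p x)) - insert v C" if "p x \<noteq> r" for x
      using that gI by simp
    have size_A: "size_T - 1 - s \<le> card (?A x)" if "x \<in> J" for x
    proof (cases "p x = r")
      case True
      then show ?thesis
        using rootA[OF True] cA C diff_card_le_card_Diff[OF finC, of A] by simp
    next
      case False
      then have px: "g (p x) \<in> C" using parent[OF that] gI by blast
      then have *: "?A x = nbs E X (g (p x)) - insert v (C - {g (p x)})"
        unfolding leafA[OF False] by auto
      have "card (insert v (C - {g (p x)})) \<le> s"
        using px finC C(3) card_Suc_Diff1[of C "g (p x)"] by (simp add: card_insert_if)
      moreover have "g (p x) \<in> X" using px C AX by auto
      ultimately show ?thesis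
        using * reg[of "g (p x)"] diff_card_le_card_Diff[of "insert v (C - {g (p x)})" "nbs E X (g (p x))"] finC
        by simp
    qed
    show "card K \<le> card (\<Union>x\<in>K. ?A x)"
    proof (rule ccontr)
      assume "\<not> ?thesis"
      then have small: "card Z < card K" by (simp add: Z_def)
      have sub: "?A x \<subseteq> Z" if "x \<in> K" for x using that unfolding Z_def by blast
      obtain x0 where x0: "x0 \<in> K" using small by fastforce
      have Z_ge: "size_T - 1 - s \<le> card Z"
        using size_A[of x0] card_mono[OF finZ sub[OF x0]] K x0 by auto
      have "card K \<le> card J" using K by (simp add: card_mono)
      moreover have "card J = size_T - s" by (simp add: size_T_def s_def)
      ultimately have cZ: "card Z = size_T - 1 - s" and "card K = card J"
        using small Z_ge by linarith+
      then have KJ: "K = J" using K by (simp add: card_subset_eq)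
      have eqZ: "?A x = Z" if "x \<in> J" for x
        using that sub[of x] size_A[of x] KJ cZ finZ by (intro card_seteq) auto
      obtain c where c: "c \<in> I" "g c = u" using uC gI by blast
      then obtain x where x: "x \<in> J" "p x = c" using nonleaf by blast
      then have uZ: "nbs E X u - insert v C = Z"
        using eqZ[OF x(1)] leafA[of x] c r_notin_I by metis
      show False
      proof (cases "root_leaves = {}")
        case False
        then obtain w where w: "w \<in> J" "p w = r" by (auto simp: root_leaves_def)
        have "A - C = Z" using eqZ[OF w(1)] rootA[OF w(2)] by metis
        moreover have "z \<in> nbs E X u - insert v C" using z C by (auto simp: A_def)
        ultimately have "z \<in> A" using uZ by blast
        then show False using z by (simp add: A_def)
      next
        case True
        then have "2 \<le> s" using root_degree[folded root_leaves_def] by (simp add: s_def)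
        then have yC: "y \<in> C" using C by (auto simp: Q_def)
        \<comment> \<open>As \<open>y\<close> is used but not adjacent to \<open>u\<close>, one
          candidate more survives than \<open>Z\<close> can hold.\<close>
        have "nbs E X u - insert v C = nbs E X u - insert v (C - {u, y})"
          using y by auto
        moreover have "card (C - {u, y}) = s - 2"
          using yC uC y finC C(3) by (simp add: card_Diff_subset)
        then have "card (insert v (C - {u, y})) \<le> s - 1"
          using finC \<open>2 \<le> s\<close> by (simp add: card_insert_if) arith
        ultimately have "size_T - 1 - (s - 1) \<le> card Z"
          using uZ reg[OF uX] diff_card_le_card_Diff[of "insert v (C - {u, y})" "nbs E X u"] finC
          by simp
        then show False using cZ m by simp
      qed
    qed
  qed
qed

lemma complete_if_dense_minimal:
  assumes fin: "finite X" and ne: "X \<noteq> {}" and free: "\<not> embeds E X"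
    and dense: "(size_T - 1) * card X \<le> degsum E X"
    and sparse: "\<And>Y. Y \<subset> X \<Longrightarrow> Y \<noteq> {} \<Longrightarrow> degsum E Y < (size_T - 1) * card Y"
  shows "card X = size_T \<and> (\<forall>u\<in>X. \<forall>v\<in>X. u \<noteq> v \<longrightarrow> E u v)"
proof -
  define m where "m = size_T"
  have m3: "3 \<le> m" using size_T_ge by (simp add: m_def)
  have deg_ge: "m \<le> 2 * card (nbs E X v)" if v: "v \<in> X" for v
  proof -
    \<comment> \<open>Deleting \<open>v\<close> costs twice its degree and must leave a sparse
      set.\<close>
    have eq: "degsum E X = degsum E (X - {v}) + 2 * card (nbs E X v)"
    proof -
      have "nbs E (X - {v}) v = nbs E X v" by auto
      then show ?thesis using degsum_insert[of "X - {v}" v] fin v by (simp add: insert_absorb)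
    qed
    have cX: "(m - 1) * card X = (m - 1) * card (X - {v}) + (m - 1)"
      using card_Suc_Diff1[OF fin v] by (metis mult_Suc_right add.commute)
    show ?thesis
    proof (cases "X - {v} = {}")
      case True
      then have "X = {v}" using v by blast
      then have "degsum E X = 0" by (simp add: degsum_def nbs_def)
      then show ?thesis using dense cX m3 by (simp add: m_def)
    next
      case False
      then have "degsum E (X - {v}) < (m - 1) * card (X - {v})"
        using sparse[of "X - {v}"] v by (auto simp: m_def)
      then show ?thesis using eq dense cX by (simp add: m_def)
    qed
  qed
  show ?thesis
  proof (cases "\<exists>v\<in>X. m \<le> card (nbs E X v)")
    case True
    then obtain b where b: "b \<in> X" "m \<le> card (nbs E X b)" by blast
    show ?thesis
    proof (cases "card deep_leaves < card I + card root_leaves")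
      case True
      \<comment> \<open>In this case \<open>card deep_leaves\<close> is less than half of
        \<open>m\<close>.\<close>
      have "card deep_leaves < card (nbs E X u)" if "u \<in> nbs E X b" for u
        using that deg_ge[of u] True by (auto simp: m_def size_T_def card_J)
      then have "embeds E X"
        using embeds_if_few_deep_leaves fin b by (simp add: m_def)
      then show ?thesis using free by simp
    next
      case False
      have "card I + card root_leaves \<le> card (nbs E X w)" if "w \<in> X" for w
        using deg_ge[OF that] False by (simp add: m_def size_T_def card_J)
      then have "\<forall>w\<in>X. \<exists>\<theta> c. \<theta> + c \<le> m \<and> 2 * c < m \<and>
          card {u \<in> nbs E X w. \<theta> \<le> card (nbs E X u)} \<le> c"
        using few_large_nbs_if_not_embeds fin free unfolding m_def by blast
      then obtain \<theta> c where \<theta>: "\<And>w. w \<in> X \<Longrightarrow> \<theta> w + c w \<le> m" "\<And>w. w \<in> X \<Longrightarrow> 2 * c w < m"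
        "\<And>w. w \<in> X \<Longrightarrow> card {u \<in> nbs E X w. \<theta> w \<le> card (nbs E X u)} \<le> c w"
        by metis
      define L where "L = {v \<in> X. card (nbs E X v) < m}"
      define B where "B = {v \<in> X. m \<le> card (nbs E X v)}"
      have LB: "X = L \<union> B" "L \<inter> B = {}" and finL: "finite L" and finB: "finite B"
        using fin by (auto simp: L_def B_def)
      have charge: "(\<Sum>w\<in>L. card (nbs E X w) + card (nbs E B w)) \<le> (m - 1) * card L"
        unfolding L_def B_def using discharging[OF fin \<theta> deg_ge] .
      \<comment> \<open>Otherwise all neighbours of \<open>b\<close>, at least \<open>m\<close> of
        them, would count as large, against \<open>2 * c b < m\<close>.\<close>
      have "L \<noteq> {}"
      proof
        assume "L = {}"
        then have "m \<le> card (nbs E X u)" if "u \<in> X" for u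
          using that unfolding L_def by (simp add: not_less)
        then have "\<theta> b \<le> card (nbs E X u)" if "u \<in> nbs E X b" for u
          using that \<theta>(1)[OF b(1)] nbs_subset[of E X b] by (meson add_leD1 order_trans subsetD)
        then have "{u \<in> nbs E X b. \<theta> b \<le> card (nbs E X u)} = nbs E X b" by blast
        then show False using \<theta>(2,3)[OF b(1)] b(2) by simp
      qed
      then have "degsum E B < (m - 1) * card B"
        using sparse[of B] b LB unfolding m_def B_def by blast
      \<comment> \<open>The second summand counts the edges meeting \<open>L\<close> twice; by
        \<open>charge\<close>, \<open>B\<close> would have to be dense.\<close>
      moreover have "degsum E X = degsum E B + (\<Sum>w\<in>L. card (nbs E X w) + card (nbs E B w))"
        using LB finL finB degsum_Un[of L B] card_nbs_Un[of L B E]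
        by (simp add: sum.distrib degsum_def)
      moreover have "card X = card L + card B"
        using LB finL finB by (simp add: card_Un_disjoint)
      ultimately have False using charge dense by (simp add: m_def add_mult_distrib2)
      then show ?thesis ..
    qed
  next
    case False
    have reg: "card (nbs E X w) = m - 1" if w: "w \<in> X" for w
    proof (rule ccontr)
      assume "card (nbs E X w) \<noteq> m - 1"
      then have "degsum E X < (\<Sum>v\<in>X. m - 1)"
        unfolding degsum_def using False w fin by (intro sum_strict_mono_ex1) force+
      then show False using dense by (simp add: m_def mult.commute)
    qed
    have closed: "insert v (nbs E X v) = X" if v: "v \<in> X" for v
    proof (rule ccontr)
      define Y where "Y = insert v (nbs E X v)"
      assume "insert v (nbs E X v) \<noteq> X"
      then have Y: "Y \<subset> X" "Y \<noteq> {}" using v by (auto simp: Y_def)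
      \<comment> \<open>Without such an edge, \<open>X\<close> would be no denser than the sparse
        sets \<open>Y\<close> and \<open>X - Y\<close>.\<close>
      have "\<exists>u\<in>Y. \<exists>z\<in>X - Y. E u z"
      proof (rule ccontr)
        assume "\<not> ?thesis"
        then have "nbs E (X - Y) u = {}" if "u \<in> Y" for u using that by (auto simp: nbs_def)
        then have "degsum E (Y \<union> (X - Y)) = degsum E Y + degsum E (X - Y)"
          using fin Y by (subst degsum_Un) (auto intro: finite_subset)
        moreover have "degsum E Y < (m - 1) * card Y" "degsum E (X - Y) < (m - 1) * card (X - Y)"
          unfolding m_def using Y by (intro sparse; blast)+
        moreover have "Y \<union> (X - Y) = X" using Y by auto
        moreover have "card X = card Y + card (X - Y)"
          using fin Y by (metis card_Diff_subset card_mono finite_subset le_add_diff_inverse psubset_imp_subset)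
        ultimately show False using dense by (simp add: m_def add_mult_distrib2)
      qed
      then obtain u z where uz: "u \<in> Y" "z \<in> X" "z \<notin> Y" "E u z" by blast
      then have "u \<in> nbs E X v" "z \<in> nbs E X u" "z \<notin> nbs E X v" "z \<noteq> v"
        using v by (auto simp: Y_def)
      then show False
        using embeds_if_regular[OF fin v] reg free by (simp add: m_def)
    qed
    obtain v where v: "v \<in> X" using ne by blast
    have "card X = Suc (card (nbs E X v))"
      using closed[OF v] fin by (metis card_insert_disjoint finite_nbs irrefl mem_nbs)
    then have "card X = m" using reg[OF v] m3 by simp
    moreover have "E u w" if "u \<in> X" "w \<in> X" "u \<noteq> w" for u w
      using closed[OF that(1)] that by (metis insert_iff mem_nbs)
    ultimately show ?thesis by (simp add: m_def)
  qed
qed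

end

section \<open>Partitions into cliques\<close>

definition clique_partition :: "('b \<Rightarrow> 'b \<Rightarrow> bool) \<Rightarrow> nat \<Rightarrow> 'b set \<Rightarrow> 'b set set \<Rightarrow> bool" where
  "clique_partition E m X P \<longleftrightarrow> partition_on X P \<and> (\<forall>C\<in>P. card C = m) \<and>
     (\<forall>u\<in>X. \<forall>v\<in>X. E u v \<longleftrightarrow> u \<noteq> v \<and> (\<exists>C\<in>P. u \<in> C \<and> v \<in> C))"

lemma Union_clique_partition:
  assumes "clique_partition E m X P"
  shows "\<Union>P = X"
  using assms partition_onD1[of X P] by (simp add: clique_partition_def)

lemma nbs_clique_partition:
  assumes "clique_partition E m X P" "C \<in> P" "v \<in> C"
  shows "nbs E X v = C - {v}"
proof -
  have P: "partition_on X P" using assms(1) by (simp add: clique_partition_def)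
  have CX: "C \<subseteq> X" using partition_onD1[OF P] assms(2) by blast
  have uniq: "C' = C" if "C' \<in> P" "v \<in> C'" for C'
    using disjointD[OF partition_onD2[OF P] that(1) assms(2)] that(2) assms(3) by blast
  have "E v u \<longleftrightarrow> v \<noteq> u \<and> u \<in> C" if "u \<in> X" for u
  proof -
    have "E v u \<longleftrightarrow> v \<noteq> u \<and> (\<exists>C\<in>P. v \<in> C \<and> u \<in> C)"
      using assms that CX unfolding clique_partition_def by blast
    then show ?thesis using uniq assms(2,3) by blast
  qed
  then show ?thesis using CX by (auto simp: nbs_def)
qed

lemma degsum_clique_partition:
  assumes "clique_partition E m X P"
  shows "degsum E X = (m - 1) * card X"
proof -
  have "card (nbs E X v) = m - 1" if v: "v \<in> X" for v
  proof -
    obtain C where C: "C \<in> P" "v \<in> C"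
      using Union_clique_partition[OF assms] v by blast
    then have "card C = m" using assms by (simp add: clique_partition_def)
    then show ?thesis
      using nbs_clique_partition[OF assms C] C(2) by (simp add: card_Diff_singleton)
  qed
  then have "degsum E X = (\<Sum>v\<in>X. m - 1)" unfolding degsum_def by (rule sum.cong[OF refl])
  then show ?thesis by simp
qed

context tree_in_graph
begin

lemma embeds_mono:
  assumes "embeds E Y" "Y \<subseteq> X"
  shows "embeds E X"
proof -
  obtain f where f: "inj_on f (insert r (I \<union> J))" "f ` insert r (I \<union> J) \<subseteq> Y"
    "\<forall>c\<in>I. E (f r) (f c)" "\<forall>x\<in>J. E (f (p x)) (f x)"
    using assms(1) unfolding embeds_def by blast
  show ?thesis
    unfolding embeds_def by (intro exI[of _ f] conjI f order_trans[OF f(2) assms(2)])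
qed

text \<open>The tree has one vertex more than \<open>C\<close>. A deep leaf \<open>a\<close> goes to
  \<open>x\<close> and its parent \<open>c\<close> to \<open>y\<close>; the other vertices fill
  \<open>C\<close> arbitrarily, since every edge avoiding \<open>a\<close> lies in the
  clique.\<close>

lemma embeds_if_clique_with_pendant:
  assumes C: "C \<subseteq> X" "card C = size_T" and clique: "\<And>u v. u \<in> C \<Longrightarrow> v \<in> C \<Longrightarrow> u \<noteq> v \<Longrightarrow> E u v"
    and y: "y \<in> C" and x: "x \<in> X" "x \<notin> C" and yx: "E y x"
  shows "embeds E X"
proof -
  define V where "V = insert r (I \<union> J)"
  have finV: "finite V" and cV: "card V = Suc size_T"
    using r_notin_I r_notin_J disj by (auto simp: V_def size_T_def card_Un_disjoint)
  have finC: "finite C" using C(2) size_T_ge by (metis card.infinite not_numeral_le_zero)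
  obtain c where c: "c \<in> I" using I_nonempty by blast
  then obtain a where a: "a \<in> J" "p a = c" using nonleaf by blast
  have ac: "a \<noteq> c" "a \<in> V" "c \<in> V" using a c disj by (auto simp: V_def)
  have "card (V - {a, c}) = card (C - {y})"
    using ac cV C(2) y finV finC by (simp add: card_Diff_subset)
  then obtain h where h: "bij_betw h (V - {a, c}) (C - {y})"
    using finV finC by (meson finite_Diff finite_same_card_bij)
  define f where "f = h(c := y, a := x)"
  have f: "f a = x" "f c = y" "\<And>w. w \<noteq> a \<Longrightarrow> w \<noteq> c \<Longrightarrow> f w = h w"
    using ac by (auto simp: f_def)
  have hC: "h w \<in> C" "h w \<noteq> y" if "w \<in> V" "w \<noteq> a" "w \<noteq> c" for w
    using bij_betwE[OF h] that by auto
  have fC: "f w \<in> C" if "w \<in> V" "w \<noteq> a" for w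
    using that hC f y by (cases "w = c") auto
  have inj: "inj_on f V"
  proof (rule inj_onI)
    fix w w' assume w: "w \<in> V" "w' \<in> V" "f w = f w'"
    consider "w = a" "w' = a" | "w \<noteq> a" "w' \<noteq> a"
      using w fC f(1) x(2) by metis
    then show "w = w'"
    proof cases
      case 2
      then consider "w = c" "w' = c" | "w \<noteq> c" "w' \<noteq> c"
        using w hC f(2,3) by metis
      then show ?thesis
      proof cases
        case 2
        then have "h w = h w'" using \<open>w \<noteq> a\<close> \<open>w' \<noteq> a\<close> w f(3) by metis
        then show ?thesis
          using inj_onD[OF bij_betw_imp_inj_on[OF h]] w 2 \<open>w \<noteq> a\<close> \<open>w' \<noteq> a\<close> by blast
      qed simp
    qed simp
  qed
  have adj: "E (f w) (f w')" if "w \<in> V" "w' \<in> V" "w \<noteq> w'" "w \<noteq> a" "w' \<noteq> a" for w w'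
    using that fC clique inj_onD[OF inj] by metis
  have "f ` V \<subseteq> X"
  proof
    fix b assume "b \<in> f ` V"
    then obtain w where "w \<in> V" "b = f w" by blast
    then show "b \<in> X" using fC[of w] f(1) C x by (cases "w = a") auto
  qed
  moreover have "E (f r) (f c')" if c': "c' \<in> I" for c'
  proof -
    have "r \<in> V" "c' \<in> V" "r \<noteq> c'" "r \<noteq> a" "c' \<noteq> a"
      using c' a r_notin_I r_notin_J disj by (auto simp: V_def)
    then show ?thesis by (rule adj)
  qed
  moreover have "E (f (p b)) (f b)" if b: "b \<in> J" for b
  proof (cases "b = a")
    case True
    then show ?thesis using a f yx by simp
  next
    case False
    have "p b \<in> V" "b \<in> V" "p b \<noteq> b" "p b \<noteq> a"
      using b a parent[OF b] r_notin_J disj by (auto simp: V_def)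
    then show ?thesis using False adj by blast
  qed
  ultimately show ?thesis using inj unfolding embeds_def V_def by blast
qed

text \<open>A dense proper subset \<open>Y\<close> splits into cliques by induction, so it attains
  the density bound exactly, and no edge leaves it, by the preceding lemma. Hence its complement is
  dense as well.\<close>

lemma clique_partition_if_dense:
  assumes "finite X" "\<not> embeds E X" "(size_T - 1) * card X \<le> degsum E X"
  shows "\<exists>P. clique_partition E size_T X P"
  using assms
proof (induction X rule: finite_psubset_induct)
  case (psubset X)
  note fin = psubset.hyps and free = psubset.prems(1) and dense = psubset.prems(2)
  consider "X = {}" | "X \<noteq> {}" "\<And>Y. Y \<subset> X \<Longrightarrow> Y \<noteq> {} \<Longrightarrow> degsum E Y < (size_T - 1) * card Y"
    | Y where "Y \<subset> X" "Y \<noteq> {}" "(size_T - 1) * card Y \<le> degsum E Y"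
    by (meson not_le)
  then show ?case
  proof cases
    case 1
    then have "clique_partition E size_T X {}" by (simp add: clique_partition_def partition_on_def)
    then show ?thesis ..
  next
    case 2
    then have "card X = size_T \<and> (\<forall>u\<in>X. \<forall>v\<in>X. u \<noteq> v \<longrightarrow> E u v)"
      using complete_if_dense_minimal[OF fin] free dense by blast
    then have "clique_partition E size_T X {X}"
      using 2(1) irrefl by (auto simp: clique_partition_def partition_on_def)
    then show ?thesis ..
  next
    case 3
    define Z where "Z = X - Y"
    have X: "X = Y \<union> Z" "Y \<inter> Z = {}" and Z: "Z \<subset> X" and finY: "finite Y" and finZ: "finite Z"
      using 3 fin by (auto simp: Z_def intro: finite_subset)
    obtain P where P: "clique_partition E size_T Y P"
      using psubset.IH[OF 3(1)] 3 free embeds_mono by blast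
    have no_cross: "\<not> E u z" if u: "u \<in> Y" and z: "z \<in> Z" for u z
    proof
      assume uz: "E u z"
      obtain C where C: "C \<in> P" "u \<in> C"
        using Union_clique_partition[OF P] u by blast
      have CY: "C \<subseteq> Y" and cC: "card C = size_T"
        using Union_clique_partition[OF P] P C(1) unfolding clique_partition_def by blast+
      have "E v w" if "v \<in> C" "w \<in> C" "v \<noteq> w" for v w
        using P C(1) CY that unfolding clique_partition_def by blast
      then have "embeds E X"
        using embeds_if_clique_with_pendant[of C X u z] C(2) CY cC X u z uz by blast
      then show False using free by simp
    qed
    then have "nbs E Z v = {}" if "v \<in> Y" for v using that by (auto simp: nbs_def)
    then have "degsum E X = degsum E Y + degsum E Z"
      unfolding X(1) using finY finZ X(2) by (subst degsum_Un) auto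
    moreover have "card X = card Y + card Z"
      using X finY finZ by (simp add: card_Un_disjoint)
    ultimately have "(size_T - 1) * card Z \<le> degsum E Z"
      using dense degsum_clique_partition[OF P] by (simp add: add_mult_distrib2)
    then obtain Q where Q: "clique_partition E size_T Z Q"
      using psubset.IH[OF Z] free embeds_mono Z by blast
    have PY: "\<Union>P = Y" and QZ: "\<Union>Q = Z"
      using P Q by (simp_all add: Union_clique_partition)
    have "clique_partition E size_T X (P \<union> Q)"
      unfolding clique_partition_def
    proof (intro conjI ballI)
      show "partition_on X (P \<union> Q)"
        using P Q X unfolding clique_partition_def partition_on_def
        by (auto simp: disjoint_union)
      show "card C = size_T" if "C \<in> P \<union> Q" for C
        using that P Q by (auto simp: clique_partition_def)
      fix u v assume uv: "u \<in> X" "v \<in> X"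
      show "E u v \<longleftrightarrow> u \<noteq> v \<and> (\<exists>C\<in>P \<union> Q. u \<in> C \<and> v \<in> C)"
      proof (cases "u \<in> Y \<longleftrightarrow> v \<in> Y")
        case True
        then consider "u \<in> Y" "v \<in> Y" | "u \<in> Z" "v \<in> Z" using uv X by blast
        then show ?thesis
        proof cases
          case 1
          then have "\<not> (\<exists>C\<in>Q. u \<in> C \<and> v \<in> C)" using QZ X by blast
          then show ?thesis using P 1 unfolding clique_partition_def by blast
        next
          case 2
          then have "\<not> (\<exists>C\<in>P. u \<in> C \<and> v \<in> C)" using PY X by blast
          then show ?thesis using Q 2 unfolding clique_partition_def by blast
        qed
      next
        case False
        then have "\<not> E u v" using uv X no_cross sym by blast
        moreover have "\<not> (\<exists>C\<in>P \<union> Q. u \<in> C \<and> v \<in> C)" using False uv PY QZ X by blast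
        ultimately show ?thesis by blast
      qed
    qed
    then show ?thesis ..
  qed
qed

end

section \<open>Trees of diameter at most four\<close>

lemma walk_Cons:
  assumes "walk G xs" "{a, hd xs} \<in> edges G" "a \<in> verts G"
  shows "walk G (a # xs)"
  using assms by (simp add: walk_def successively_Cons)

lemma walk_append:
  assumes "walk G xs" "walk G ys" "last xs = hd ys"
  shows "walk G (xs @ tl ys)"
  using assms by (cases ys) (auto simp: walk_def successively_append_iff successively_Cons)

lemma walk_rev:
  assumes "walk G xs"
  shows "walk G (rev xs)"
  using assms by (simp add: walk_def successively_rev insert_commute)

text \<open>The stretch between two visits to one vertex can be cut out.\<close>

lemma walk_distinct:
  assumes "walk G xs"
  shows "\<exists>ys. walk G ys \<and> distinct ys \<and> hd ys = hd xs \<and> last ys = last xs \<and>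
    set ys \<subseteq> set xs \<and> length ys \<le> length xs"
  using assms
proof (induction xs rule: length_induct)
  case (1 xs)
  show ?case
  proof (cases "distinct xs")
    case False
    then obtain as bs cs y where xs: "xs = as @ [y] @ bs @ [y] @ cs"
      using not_distinct_decomp by blast
    define zs where "zs = as @ [y] @ cs"
    have "walk G zs"
      using "1.prems" by (auto simp: xs zs_def walk_def successively_append_iff successively_Cons)
    moreover have "length zs < length xs" by (simp add: xs zs_def)
    ultimately obtain ys where "walk G ys" "distinct ys" "hd ys = hd zs" "last ys = last zs"
      "set ys \<subseteq> set zs" "length ys \<le> length zs"
      using "1.IH" by blast
    moreover have "hd zs = hd xs" "last zs = last xs" "set zs \<subseteq> set xs" "length zs \<le> length xs"
      by (auto simp: xs zs_def hd_append)
    ultimately show ?thesis by (metis order_trans)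
  qed (use 1 in blast)
qed

text \<open>Distance at most \<open>k\<close>, without the \<open>LEAST\<close> of
  \<open>graph_dist\<close>.\<close>

definition reach :: "'a graph \<Rightarrow> nat \<Rightarrow> 'a \<Rightarrow> 'a \<Rightarrow> bool" where
  "reach G k u v \<longleftrightarrow> (\<exists>xs. walk G xs \<and> hd xs = u \<and> last xs = v \<and> length xs \<le> Suc k)"

lemma reach_mono: "reach G k u v \<Longrightarrow> k \<le> l \<Longrightarrow> reach G l u v"
  unfolding reach_def by force

lemma reach_sym:
  assumes "reach G k u v"
  shows "reach G k v u"
proof -
  obtain xs where xs: "walk G xs" "hd xs = u" "last xs = v" "length xs \<le> Suc k"
    using assms unfolding reach_def by blast
  then have "xs \<noteq> []" by (simp add: walk_def)
  then show ?thesis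
    unfolding reach_def using xs walk_rev
    by (intro exI[of _ "rev xs"]) (simp add: hd_rev last_rev)
qed

lemma reach_Cons:
  assumes "reach G k u v" "{a, u} \<in> edges G" "a \<in> verts G"
  shows "reach G (Suc k) a v"
proof -
  obtain xs where xs: "walk G xs" "hd xs = u" "last xs = v" "length xs \<le> Suc k"
    using assms unfolding reach_def by blast
  then have "xs \<noteq> []" by (simp add: walk_def)
  then show ?thesis
    unfolding reach_def using xs assms walk_Cons[OF xs(1), of a]
    by (intro exI[of _ "a # xs"]) simp
qed

lemma reach_diameter:
  assumes "finite (verts G)" "connected_graph G" "u \<in> verts G" "v \<in> verts G"
  shows "reach G (diameter G) u v"
proof -
  let ?P = "\<lambda>d. \<exists>xs. walk G xs \<and> hd xs = u \<and> last xs = v \<and> length xs = Suc d"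
  obtain xs where xs: "walk G xs" "hd xs = u" "last xs = v"
    using assms unfolding connected_graph_def by blast
  then have "length xs = Suc (length xs - 1)" by (cases xs) (auto simp: walk_def)
  then have "?P (length xs - 1)" using xs by blast
  then have "?P (graph_dist G u v)"
    unfolding graph_dist_def by (rule LeastI)
  then have "reach G (graph_dist G u v) u v" unfolding reach_def by auto
  moreover have "graph_dist G u v \<le> diameter G"
  proof -
    have "{graph_dist G u v |u v. u \<in> verts G \<and> v \<in> verts G}
        = (\<lambda>(u, v). graph_dist G u v) ` (verts G \<times> verts G)" by auto
    then have "finite {graph_dist G u v |u v. u \<in> verts G \<and> v \<in> verts G}"
      using assms(1) by simp
    then show ?thesis
      unfolding diameter_def using assms(3,4) by (intro Max_ge) blast+
  qed
  ultimately show ?thesis by (rule reach_mono)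
qed

section \<open>Acyclicity and the centre\<close>

lemma edge_simple_graph:
  assumes "simple_graph G" "{u, v} \<in> edges G"
  shows "u \<in> verts G" "v \<in> verts G" "u \<noteq> v"
  using assms unfolding simple_graph_def by fastforce+

text \<open>Two distinct neighbours of \<open>a\<close> joined by a walk avoiding \<open>a\<close>
  would close a cycle through \<open>a\<close>. All uses of acyclicity take this form.\<close>

lemma acyclic_nbs_eq:
  assumes T: "tree T" and a: "{a, hd xs} \<in> edges T" "{a, last xs} \<in> edges T"
    and xs: "walk T xs" "a \<notin> set xs"
  shows "hd xs = last xs"
proof (rule ccontr)
  assume neq: "hd xs \<noteq> last xs"
  obtain ys where ys: "walk T ys" "distinct ys" "hd ys = hd xs" "last ys = last xs"
    "set ys \<subseteq> set xs"
    using walk_distinct[OF xs(1)] by blast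
  have "a \<in> verts T" using T edge_simple_graph(1)[OF _ a(1)] by (simp add: tree_def)
  then have "walk T (a # ys)" using ys a walk_Cons by metis
  moreover have "distinct (a # ys)" using ys xs by auto
  moreover have "ys \<noteq> []" using ys(1) by (simp add: walk_def)
  moreover have "length ys \<noteq> 1"
    using neq ys(3,4) by (metis One_nat_def length_0_conv length_Suc_conv last_ConsL list.sel(1))
  ultimately have "3 \<le> length (a # ys)" by (cases ys) (auto simp: Suc_le_eq)
  moreover have "{last (a # ys), hd (a # ys)} \<in> edges T"
    using \<open>ys \<noteq> []\<close> ys(4) a(2) by (simp add: insert_commute)
  ultimately have "cycle T (a # ys)"
    using \<open>walk T (a # ys)\<close> \<open>distinct (a # ys)\<close> unfolding cycle_def by blast
  then show False using T unfolding tree_def by blast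
qed

text \<open>
  A vertex \<open>r\<close> of minimal eccentricity works. If some \<open>y\<close> had distance at least three from \<open>r\<close>,
  then, the diameter being at most four, every vertex outside the branch towards \<open>y\<close> would have
  distance at most one from \<open>r\<close>, and the first vertex of that branch would have smaller eccentricity.
\<close>

lemma tree_center:
  assumes T: "tree T" and diam: "diameter T \<le> 4"
  shows "\<exists>r\<in>verts T. \<forall>z\<in>verts T. reach T 2 r z"
proof -
  have simple: "simple_graph T" and conn: "connected_graph T"
    using T by (auto simp: tree_def)
  have reach4: "reach T 4 u v" if "u \<in> verts T" "v \<in> verts T" for u v
    using reach_diameter[of T u v] reach_mono diam simple conn that
    by (metis simple_graph_def)
  define ecc where "ecc k \<longleftrightarrow> (\<exists>r\<in>verts T. \<forall>z\<in>verts T. reach T k r z)" for k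
  define k where "k = (LEAST k. ecc k)"
  have "ecc 4" using conn reach4 unfolding ecc_def connected_graph_def by blast
  then have "ecc k" unfolding k_def by (rule LeastI)
  then obtain r where r: "r \<in> verts T" "\<And>z. z \<in> verts T \<Longrightarrow> reach T k r z"
    unfolding ecc_def by blast
  show ?thesis
  proof (cases "k \<le> 2")
    case True
    then show ?thesis using r reach_mono by metis
  next
    case False
    then obtain l where l: "k = Suc l" "2 \<le> l" by (cases k) auto
    then have "\<not> ecc l" using not_less_Least[of l ecc] by (simp add: k_def)
    then obtain y where y: "y \<in> verts T" "\<not> reach T l r y"
      using r(1) unfolding ecc_def by blast
    then have y2: "\<not> reach T 2 r y" using l(2) reach_mono by metis
    obtain ys where ys: "walk T ys" "hd ys = r" "last ys = y" "distinct ys"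
      using r(2)[OF y(1)] walk_distinct unfolding reach_def by metis
    have "y \<noteq> r"
    proof
      assume "y = r"
      then have "reach T 2 r y"
        unfolding reach_def using r(1) by (intro exI[of _ "[r]"]) (simp add: walk_def)
      then show False using y2 by simp
    qed
    then obtain b bs where bs: "ys = r # b # bs"
      using ys by (cases ys; cases "tl ys") (auto simp: walk_def)
    have rb: "{r, b} \<in> edges T" and walk_b: "walk T (b # bs)" and r_bs: "r \<notin> set (b # bs)"
      and last_bs: "last (b # bs) = y"
      using ys bs by (auto simp: walk_def)
    have b: "b \<in> verts T" using rb simple edge_simple_graph by metis
    have "reach T l b z" if z: "z \<in> verts T" for z
    proof -
      obtain zs where zs: "walk T zs" "hd zs = r" "last zs = z" "length zs \<le> Suc k" "distinct zs"
        using r(2)[OF z] walk_distinct unfolding reach_def by (metis order_trans)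
      show ?thesis
      proof (cases "reach T 1 r z")
        case True
        then have "reach T (Suc 1) b z"
          using rb b by (intro reach_Cons[of T 1 r z b]) (simp_all add: insert_commute)
        then show ?thesis using l(2) by (auto intro: reach_mono)
      next
        case far: False
        have "length zs > 1"
        proof (rule ccontr)
          assume "\<not> ?thesis"
          then have "reach T 1 r z" unfolding reach_def using zs by (intro exI[of _ zs]) simp
          then show False using far by simp
        qed
        then obtain d ds where ds: "zs = r # d # ds"
          using zs by (cases zs; cases "tl zs") auto
        have rd: "{r, d} \<in> edges T" and walk_d: "walk T (d # ds)" and r_ds: "r \<notin> set (d # ds)"
          and last_ds: "last (d # ds) = z" and len: "length (d # ds) \<le> Suc l"
          using zs ds l by (auto simp: walk_def)
        obtain ws where ws: "walk T ws" "hd ws = z" "last ws = y" "length ws \<le> Suc 4"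
          using reach4[OF z y(1)] unfolding reach_def by blast
        have ws_ne: "ws \<noteq> []" using ws(1) by (simp add: walk_def)
        show ?thesis
        proof (cases "r \<in> set ws")
          case True
          \<comment> \<open>The part of \<open>ws\<close> up to \<open>r\<close> has at least two
            edges and the part after it at least three, against the bound of four.\<close>
          then obtain as cs where split: "ws = as @ r # cs" by (meson split_list)
          have "walk T (as @ [r])" "walk T (r # cs)"
            using ws(1) by (auto simp: split walk_def successively_append_iff successively_Cons)
          moreover have "hd (as @ [r]) = z" "last (r # cs) = y"
            using ws(2,3) by (cases as; simp add: split)+
          ultimately have "reach T (length as) z r" and "reach T (length cs) r y"
            unfolding reach_def by force+
          then have "\<not> length as \<le> 1" "\<not> length cs \<le> 2"
            using far y2 reach_sym reach_mono by metis+
          then show ?thesis using ws(4) by (simp add: split)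
        next
          case False
          \<comment> \<open>From \<open>d\<close> via \<open>z\<close> and \<open>y\<close>, then
            back along the branch to \<open>b\<close>: the walk \<open>vs\<close> avoids
            \<open>r\<close>, so \<open>d = b\<close>, and dropping \<open>r\<close> from
            \<open>zs\<close> gives a walk from \<open>b\<close> of at most \<open>l\<close>
            edges.\<close>
          define us where "us = (d # ds) @ tl ws"
          have us: "walk T us" "last us = y" "hd us = d" "r \<notin> set us"
            using walk_append[OF walk_d ws(1)] last_ds ws False ws_ne r_ds
            by (auto simp: us_def last_append last_tl dest: list.set_sel(2) split: if_splits)
              (metis last_ConsL list.collapse)+
          define vs where "vs = us @ tl (rev (b # bs))"
          have "walk T vs"
            unfolding vs_def using us(2) last_bs
            by (intro walk_append us(1) walk_rev walk_b) (simp only: hd_rev)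
          moreover have "last vs = b"
          proof (cases "bs = []")
            case True
            then show ?thesis using us(2) last_bs by (simp add: vs_def)
          next
            case False
            then show ?thesis by (cases "rev bs") (auto simp: vs_def)
          qed
          moreover have "hd vs = d" using us by (simp add: vs_def walk_def)
          moreover have "r \<notin> set vs"
          proof -
            have "set (tl xs) \<subseteq> set xs" for xs :: "'a list" by (cases xs) auto
            from this[of "rev (b # bs)"] show ?thesis using us(4) r_bs by (auto simp: vs_def)
          qed
          ultimately have "d = b" using acyclic_nbs_eq[OF T, of r vs] rd rb by simp
          then show ?thesis
            unfolding reach_def using walk_d last_ds len by (intro exI[of _ "d # ds"]) simp
        qed
      qed
    qed
    then have "ecc l" using b unfolding ecc_def by blast
    then show ?thesis using \<open>\<not> ecc l\<close> by simp
  qed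
qed

section \<open>Stars and the levels of the tree\<close>

lemma is_star_if_center:
  assumes fin: "finite (verts G)" and c: "c \<in> verts G"
    and edges: "edges G = {{c, x} |x. x \<in> verts G - {c}}"
  shows "is_star G"
proof -
  define t where "t = card (verts G - {c})"
  obtain h where h: "bij_betw h (verts G - {c}) {1..t}"
    using finite_same_card_bij[of "verts G - {c}" "{1..t}"] fin unfolding t_def by fastforce
  define f where "f = h(c := 0)"
  have fc: "f c = 0" by (simp add: f_def)
  have fx: "f x \<in> {1..t}" if "x \<in> verts G" "x \<noteq> c" for x
    using bij_betwE[OF h] that by (simp add: f_def)
  have "bij_betw f (verts G - {c}) {1..t} = bij_betw h (verts G - {c}) {1..t}"
    by (rule bij_betw_cong) (simp add: f_def)
  then have "bij_betw f ({c} \<union> (verts G - {c})) ({0} \<union> {1..t})"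
    using h fc by (intro bij_betw_combine) (simp_all add: bij_betw_def)
  moreover have "{c} \<union> (verts G - {c}) = verts G" "{0} \<union> {1..t} = {0..t}"
    using c by auto
  ultimately have bij: "bij_betw f (verts G) {0..t}" by simp
  have "{u, v} \<in> edges G \<longleftrightarrow> {f u, f v} \<in> edges (star_graph t)"
    if uv: "u \<in> verts G" "v \<in> verts G" for u v
  proof -
    have L: "{u, v} \<in> edges G \<longleftrightarrow> u = c \<and> v \<noteq> c \<or> v = c \<and> u \<noteq> c"
      using uv by (auto simp: edges doubleton_eq_iff)
    have R: "{f u, f v} \<in> edges (star_graph t) \<longleftrightarrow>
        f u = 0 \<and> f v \<in> {1..t} \<or> f v = 0 \<and> f u \<in> {1..t}"
      by (auto simp: star_graph_def doubleton_eq_iff)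
    show ?thesis
      unfolding L R using fc fx[OF uv(1)] fx[OF uv(2)] by (cases "u = c"; cases "v = c") auto
  qed
  then have "isomorphic G (star_graph t)"
    unfolding isomorphic_def using bij by (intro exI[of _ f]) (simp add: star_graph_def)
  then show ?thesis unfolding is_star_def ..
qed

lemma reach_2_cases:
  assumes "reach G 2 u v"
  obtains "v = u" | "{u, v} \<in> edges G" | w where "{u, w} \<in> edges G" "{w, v} \<in> edges G"
proof -
  obtain xs where xs: "walk G xs" "hd xs = u" "last xs = v" "length xs \<le> 3"
    using assms unfolding reach_def by auto
  then consider a where "xs = [a]" | a b where "xs = [a, b]" | a b c where "xs = [a, b, c]"
    by (cases xs; cases "tl xs"; cases "tl (tl xs)") (auto simp: walk_def)
  then show thesis
  proof cases
    case 1
    then show thesis using xs that(1) by simp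
  next
    case 2
    then show thesis using xs that(2) by (simp add: walk_def)
  next
    case 3
    then show thesis using xs that(3)[of "hd (tl xs)"] by (simp add: walk_def)
  qed
qed

text \<open>The root is a centre; acyclicity excludes edges within a level and second parents. If
  \<open>I\<close> were empty or the root had degree one, the tree would be a star.\<close>

lemma tree_height_two:
  assumes T: "tree T" and diam: "diameter T \<le> 4" and no_star: "\<not> is_star T"
  shows "\<exists>r I J p. height_two_tree r I J p \<and> verts T = insert r (I \<union> J) \<and>
    edges T = (\<lambda>c. {r, c}) ` I \<union> (\<lambda>x. {p x, x}) ` J"
proof -
  have simple: "simple_graph T" using T by (simp add: tree_def)
  have fin: "finite (verts T)" using simple by (simp add: simple_graph_def)
  define A where "A u v \<longleftrightarrow> {u, v} \<in> edges T" for u v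
  have A_sym: "A v u" if "A u v" for u v using that by (simp add: A_def insert_commute)
  have A_V: "u \<in> verts T" "v \<in> verts T" "u \<noteq> v" if "A u v" for u v
    using that edge_simple_graph[OF simple, of u v] by (auto simp: A_def)
  have nb: "b = c" if "A a b" "A a c" "walk T xs" "hd xs = b" "last xs = c" "a \<notin> set xs" for a b c xs
    using acyclic_nbs_eq[OF T, of a xs] that by (simp add: A_def)
  have walk2: "walk T [u, v]" if "A u v" for u v
    using that A_V[OF that] by (simp add: walk_def A_def)
  have walk3: "walk T [u, v, w]" if "A u v" "A v w" for u v w
    using that A_V[OF that(1)] A_V[OF that(2)] by (simp add: walk_def A_def)
  have walk4: "walk T [u, v, w, x]" if "A u v" "A v w" "A w x" for u v w x
    using that A_V[OF that(1)] A_V[OF that(3)] by (simp add: walk_def A_def)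
  obtain r where r: "r \<in> verts T" "\<And>z. z \<in> verts T \<Longrightarrow> reach T 2 r z"
    using tree_center[OF T diam] by blast
  define Ch where "Ch = {c. A r c}"
  define I where "I = {c \<in> Ch. \<exists>x. A c x \<and> x \<noteq> r}"
  define J where "J = verts T - {r} - I"
  \<comment> \<open>The choice is harmless: \<open>p_unique\<close> shows that the parent is
    determined.\<close>
  define p where "p x = (if x \<in> Ch then r else SOME c. c \<in> Ch \<and> A c x)" for x
  have Ch_r: "r \<notin> Ch" using A_V(3) by (auto simp: Ch_def)
  have Ch_indep: "\<not> A c c'" if "c \<in> Ch" "c' \<in> Ch" for c c'
  proof
    assume cc: "A c c'"
    have "r = c'"
    proof (rule nb[of c r c' "[r, c']"])
      show "A c r" "A c c'" using that A_sym cc by (auto simp: Ch_def)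
      show "walk T [r, c']" using that walk2 by (simp add: Ch_def)
      show "c \<notin> set [r, c']" using that Ch_r A_V(3)[OF cc] by auto
    qed simp_all
    then show False using that Ch_r by simp
  qed
  have p_deep: "p x \<in> Ch" "A (p x) x" if "x \<in> verts T" "x \<noteq> r" "x \<notin> Ch" for x
  proof -
    have "\<exists>c. c \<in> Ch \<and> A c x"
      using r(2)[OF that(1)] by (cases rule: reach_2_cases) (use that in \<open>auto simp: Ch_def A_def\<close>)
    from someI_ex[OF this] have "p x \<in> Ch \<and> A (p x) x" unfolding p_def using that(3) by simp
    then show "p x \<in> Ch" "A (p x) x" by auto
  qed
  have p_unique: "p x = c" if "c \<in> Ch" "A c x" "x \<noteq> r" for c x
  proof -
    have x: "x \<in> verts T" "x \<notin> Ch" using A_V[OF that(2)] Ch_indep that by blast+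
    note px = p_deep[OF x(1) that(3) x(2)]
    show ?thesis
    proof (rule nb[of x "p x" c "[p x, r, c]"])
      show "A x (p x)" "A x c" using px that A_sym by auto
      show "walk T [p x, r, c]" using px that walk3 A_sym by (simp add: Ch_def)
      show "x \<notin> set [p x, r, c]" using px that A_V(3)[OF px(2)] A_V(3)[OF that(2)] by auto
    qed simp_all
  qed
  have p_J: "x \<in> Ch \<and> p x = r \<or> x \<notin> Ch \<and> p x \<in> I \<and> A (p x) x" if "x \<in> J" for x
  proof (cases "x \<in> Ch")
    case True
    then show ?thesis by (simp add: p_def)
  next
    case False
    then show ?thesis using p_deep[of x] that by (auto simp: I_def J_def)
  qed
  have IV: "I \<subseteq> verts T" using A_V(2) by (auto simp: I_def Ch_def)
  have verts: "verts T = insert r (I \<union> J)" using r(1) IV by (auto simp: J_def)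
  have edge: "{a, b} \<in> (\<lambda>c. {r, c}) ` I \<union> (\<lambda>x. {p x, x}) ` J"
    if ab: "A a b" and deep: "b \<notin> Ch" "b \<noteq> r" for a b
  proof -
    have bV: "b \<in> verts T" using A_V[OF ab] by simp
    have bJ: "b \<in> J" using bV deep by (simp add: J_def I_def)
    note pb = p_deep[OF bV deep(2,1)]
    have "a \<noteq> r" using ab deep by (auto simp: Ch_def)
    \<comment> \<open>Two adjacent vertices at depth two would close a cycle through their parents.
      Since \<open>nb\<close> takes any walk, the parents may coincide.\<close>
    have "a \<in> Ch"
    proof (rule ccontr)
      assume a: "a \<notin> Ch"
      note pa = p_deep[OF A_V(1)[OF ab] \<open>a \<noteq> r\<close> a]
      have "p a = b"
      proof (rule nb[of a "p a" b "[p a, r, p b, b]"])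
        show "A a (p a)" "A a b" using pa ab A_sym by auto
        show "walk T [p a, r, p b, b]" using pa pb walk4 A_sym by (simp add: Ch_def)
        show "a \<notin> set [p a, r, p b, b]"
          using a \<open>a \<noteq> r\<close> pa(1) pb(1) A_V(3)[OF ab] by auto
      qed simp_all
      then show False using pa(1) deep by simp
    qed
    then have "p b = a" using p_unique ab deep by simp
    then show ?thesis using bJ by blast
  qed
  have edges: "edges T = (\<lambda>c. {r, c}) ` I \<union> (\<lambda>x. {p x, x}) ` J"
  proof
    show "edges T \<subseteq> (\<lambda>c. {r, c}) ` I \<union> (\<lambda>x. {p x, x}) ` J"
    proof
      fix e assume e: "e \<in> edges T"
      then have "card e = 2" using simple by (simp add: simple_graph_def)
      then obtain a b where ab: "e = {a, b}" by (auto simp: card_2_iff)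
      then have A: "A a b" "A b a" using e by (simp_all add: A_def insert_commute)
      have root: "{r, c} \<in> (\<lambda>c. {r, c}) ` I \<union> (\<lambda>x. {p x, x}) ` J" if "A r c" for c
      proof (cases "c \<in> I")
        case False
        then have "c \<in> J" using A_V[OF that] by (simp add: J_def)
        moreover have "p c = r" using that by (simp add: p_def Ch_def)
        ultimately show ?thesis by (metis (mono_tags, lifting) UnI2 image_eqI)
      qed blast
      consider "a = r" | "b = r" | "a \<noteq> r" "b \<notin> Ch" "b \<noteq> r" | "b \<noteq> r" "a \<notin> Ch" "a \<noteq> r"
        using Ch_indep A by blast
      then show "e \<in> (\<lambda>c. {r, c}) ` I \<union> (\<lambda>x. {p x, x}) ` J"
      proof cases
        case 1
        then show ?thesis using root[of b] A ab by simp
      next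
        case 2
        then show ?thesis using root[of a] A ab by (simp add: insert_commute)
      next
        case 3
        then show ?thesis using edge[OF A(1)] ab by simp
      next
        case 4
        then show ?thesis using edge[OF A(2)] ab by (simp add: insert_commute)
      qed
    qed
    show "(\<lambda>c. {r, c}) ` I \<union> (\<lambda>x. {p x, x}) ` J \<subseteq> edges T"
    proof -
      have "{r, c} \<in> edges T" if "c \<in> I" for c using that by (simp add: I_def Ch_def A_def)
      moreover have "{p x, x} \<in> edges T" if "x \<in> J" for x
        using p_J[OF that] by (auto simp: Ch_def A_def)
      ultimately show ?thesis by blast
    qed
  qed
  have r_notin: "r \<notin> I" "r \<notin> J" using Ch_r by (auto simp: I_def J_def)
  have disj: "I \<inter> J = {}" by (auto simp: J_def)
  have finIJ: "finite I" "finite J" using fin IV by (auto simp: J_def intro: finite_subset)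
  have I_ne: "I \<noteq> {}"
  proof
    assume "I = {}"
    then have "p x = r" if "x \<in> J" for x using p_J[OF that] by auto
    then have "edges T = {{r, x} |x. x \<in> verts T - {r}}"
      using \<open>I = {}\<close> r_notin unfolding edges verts by auto
    then show False using is_star_if_center[OF fin r(1)] no_star by blast
  qed
  have "2 \<le> card I + card {x \<in> J. p x = r}"
  proof (rule ccontr)
    assume "\<not> ?thesis"
    moreover have "card I \<noteq> 0" using I_ne finIJ by simp
    \<comment> \<open>The root would be a leaf hanging from the only child \<open>c\<close>, the
      centre of a star.\<close>
    ultimately have "card I = 1" "card {x \<in> J. p x = r} = 0" by linarith+
    then obtain c where c: "I = {c}" and no_leaf: "{x \<in> J. p x = r} = {}"
      using finIJ by (auto simp: card_1_singleton_iff)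
    have "p x = c" if "x \<in> J" for x using p_J[OF that] no_leaf that c by blast
    then have "edges T = {{c, x} |x. x \<in> verts T - {c}}"
      unfolding edges verts using c r_notin disj by (auto simp: insert_commute)
    moreover have "c \<in> verts T" using c IV by simp
    ultimately show False using is_star_if_center[OF fin] no_star by blast
  qed
  moreover have "\<exists>x\<in>J. p x = c" if c: "c \<in> I" for c
  proof -
    obtain x where x: "A c x" "x \<noteq> r" "c \<in> Ch" using c by (auto simp: I_def)
    then have "x \<in> J" using A_V[OF x(1)] Ch_indep by (auto simp: J_def I_def)
    then show ?thesis using p_unique x by blast
  qed
  ultimately have "height_two_tree r I J p"
    using r_notin disj finIJ I_ne p_J by unfold_locales auto
  then show ?thesis using verts edges by blast
qed

section \<open>Transfer to set-based graphs\<close>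

text \<open>The handshake lemma: each edge is counted at both ends.\<close>

lemma sum_degree_eq:
  assumes G: "simple_graph G"
  shows "degsum (\<lambda>u v. {u, v} \<in> edges G) (verts G) = 2 * card (edges G)"
proof -
  have finV: "finite (verts G)" using G by (simp add: simple_graph_def)
  have "edges G \<subseteq> Pow (verts G)" using G by (auto simp: simple_graph_def)
  then have finE: "finite (edges G)" using finV by (meson finite_Pow_iff finite_subset)
  have "card (nbs (\<lambda>u v. {u, v} \<in> edges G) (verts G) v) = card {e \<in> edges G. v \<in> e}" for v
  proof (rule bij_betw_same_card)
    show "bij_betw (\<lambda>u. {v, u}) (nbs (\<lambda>u v. {u, v} \<in> edges G) (verts G) v) {e \<in> edges G. v \<in> e}"
      unfolding bij_betw_def
    proof
      show "inj_on (\<lambda>u. {v, u}) (nbs (\<lambda>u v. {u, v} \<in> edges G) (verts G) v)"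
        by (rule inj_onI) (auto simp: doubleton_eq_iff)
      show "(\<lambda>u. {v, u}) ` nbs (\<lambda>u v. {u, v} \<in> edges G) (verts G) v = {e \<in> edges G. v \<in> e}"
      proof
        show "{e \<in> edges G. v \<in> e} \<subseteq> (\<lambda>u. {v, u}) ` nbs (\<lambda>u v. {u, v} \<in> edges G) (verts G) v"
        proof
          fix e assume e: "e \<in> {e \<in> edges G. v \<in> e}"
          then have "card e = 2" "e \<subseteq> verts G" using G by (auto simp: simple_graph_def)
          then obtain a b where "e = {a, b}" by (auto simp: card_2_iff)
          then obtain u where u: "e = {v, u}" using e by blast
          then have "u \<in> nbs (\<lambda>u v. {u, v} \<in> edges G) (verts G) v"
            using e \<open>e \<subseteq> verts G\<close> by simp
          then show "e \<in> (\<lambda>u. {v, u}) ` nbs (\<lambda>u v. {u, v} \<in> edges G) (verts G) v"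
            unfolding u by (rule imageI)
        qed
      qed auto
    qed
  qed
  then have "degsum (\<lambda>u v. {u, v} \<in> edges G) (verts G) = (\<Sum>v\<in>verts G. card {e \<in> edges G. v \<in> e})"
    by (simp add: degsum_def)
  also have "\<dots> = 2 * card (edges G)"
  proof (rule sum_multicount[OF finV finE], rule ballI)
    fix e assume "e \<in> edges G"
    then have "card e = 2" "{v \<in> verts G. v \<in> e} = e" using G by (auto simp: simple_graph_def)
    then show "card {v \<in> verts G. v \<in> e} = 2" by simp
  qed
  finally show ?thesis .
qed

lemma not_free_of_if_embedding:
  assumes T: "simple_graph T" and inj: "inj_on f (verts T)" and fV: "f ` verts T \<subseteq> verts G"
    and edge: "\<And>u v. {u, v} \<in> edges T \<Longrightarrow> {f u, f v} \<in> edges G"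
  shows "\<not> free_of T G"
proof -
  \<comment> \<open>Only the images of edges of \<open>T\<close> are kept, because
    \<open>isomorphic\<close> allows no further edges between image vertices.\<close>
  define H where "H = (f ` verts T, (`) f ` edges T)"
  have sub: "e \<subseteq> verts T" "card e = 2" if "e \<in> edges T" for e
    using T that by (auto simp: simple_graph_def)
  have "simple_graph H"
    unfolding simple_graph_def H_def using T sub
    by (auto simp: simple_graph_def card_image inj_on_subset[OF inj])
  moreover have "edges H \<subseteq> edges G"
  proof
    fix e assume "e \<in> edges H"
    then obtain d where d: "d \<in> edges T" "e = f ` d" by (auto simp: H_def)
    then obtain u v where "d = {u, v}" using sub by (metis card_2_iff)
    then show "e \<in> edges G" using d edge by simp
  qed
  ultimately have "subgraph H G" using fV by (simp add: subgraph_def H_def)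
  moreover have "isomorphic T H"
    unfolding isomorphic_def
  proof (intro exI[of _ f] conjI ballI)
    show "bij_betw f (verts T) (verts H)" using inj by (simp add: bij_betw_def H_def)
    fix u v assume uv: "u \<in> verts T" "v \<in> verts T"
    show "{u, v} \<in> edges T \<longleftrightarrow> {f u, f v} \<in> edges H"
    proof
      assume "{u, v} \<in> edges T"
      then have "f ` {u, v} \<in> edges H" unfolding H_def snd_conv by (rule imageI)
      then show "{f u, f v} \<in> edges H" by simp
    next
      assume "{f u, f v} \<in> edges H"
      then obtain d where d: "d \<in> edges T" "f ` {u, v} = f ` d" by (auto simp: H_def)
      then have "{u, v} = d"
        using inj_on_image_eq_iff[OF inj, of "{u, v}" d] uv sub(1)[OF d(1)] by simp
      then show "{u, v} \<in> edges T" using d by simp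
    qed
  qed
  ultimately show ?thesis unfolding free_of_def by blast
qed

theorem theorem1:
  fixes T :: "'a graph"
  assumes "tree T" and "diameter T \<le> 4" and "\<not> is_star T"
  shows "strong_erdos_sos TYPE('b) T"
  unfolding strong_erdos_sos_def
proof (intro allI impI, elim conjE)
  fix n and G :: "'b graph"
  assume G: "simple_graph G" and n: "card (verts G) = n" and free: "free_of T G"
    and e: "real (card (edges G)) = (real (card (verts T)) - 2) / 2 * real n"
  obtain r I J p where "height_two_tree r I J p"
    and verts_T: "verts T = insert r (I \<union> J)"
    and edges_T: "edges T = (\<lambda>c. {r, c}) ` I \<union> (\<lambda>x. {p x, x}) ` J"
    using tree_height_two[OF assms] by (elim exE conjE) (rule that)
  then interpret height_two_tree r I J p by simp
  define E where "E u v \<longleftrightarrow> {u, v} \<in> edges G" for u v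
  interpret tree_in_graph r I J p E
  proof unfold_locales
    show "E v u" if "E u v" for u v using that by (simp add: E_def insert_commute)
    show "\<not> E v v" for v using edge_simple_graph(3)[OF G, of v v] by (auto simp: E_def)
  qed
  have finG: "finite (verts G)" using G by (simp add: simple_graph_def)
  have card_T: "card (verts T) = Suc size_T"
    using r_notin_I r_notin_J disj by (simp add: verts_T size_T_def card_Un_disjoint)
  have not_emb: "\<not> embeds E (verts G)"
  proof
    assume "embeds E (verts G)"
    then obtain f where f: "inj_on f (insert r (I \<union> J))" "f ` insert r (I \<union> J) \<subseteq> verts G"
      and fI: "\<forall>c\<in>I. E (f r) (f c)" and fJ: "\<forall>x\<in>J. E (f (p x)) (f x)"
      unfolding embeds_def by blast
    have "{f u, f v} \<in> edges G" if "{u, v} \<in> edges T" for u v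
    proof -
      have "f ` {u, v} \<in> edges G"
        using that unfolding edges_T
      proof (elim UnE imageE)
        fix c assume "{u, v} = {r, c}" "c \<in> I"
        then show "f ` {u, v} \<in> edges G" using fI by (simp add: E_def)
      next
        fix x assume "{u, v} = {p x, x}" "x \<in> J"
        then show "f ` {u, v} \<in> edges G" using fJ by (simp add: E_def)
      qed
      then show ?thesis by simp
    qed
    then show False
      using not_free_of_if_embedding[OF _ f[folded verts_T]] free assms(1) by (simp add: tree_def)
  qed
  \<comment> \<open>As \<open>size_T\<close> is positive, the truncated difference agrees with the
    real one.\<close>
  have "real (2 * card (edges G)) = real ((size_T - 1) * card (verts G))"
    using e card_T size_T_ge(1) n by (simp add: of_nat_diff)
  then have "2 * card (edges G) = (size_T - 1) * card (verts G)" by (simp only: of_nat_eq_iff)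
  moreover have "degsum E (verts G) = 2 * card (edges G)"
    unfolding E_def using sum_degree_eq[OF G] .
  ultimately obtain P where P: "clique_partition E size_T (verts G) P"
    using clique_partition_if_dense[OF finG not_emb] by auto
  have "edges G = (\<Union>C\<in>P. complete_edges C)"
  proof (rule set_eqI)
    fix e
    have clique: "E u v \<longleftrightarrow> u \<noteq> v \<and> (\<exists>C\<in>P. u \<in> C \<and> v \<in> C)"
      if "u \<in> verts G" "v \<in> verts G" for u v
      using P that by (simp add: clique_partition_def)
    show "e \<in> edges G \<longleftrightarrow> e \<in> (\<Union>C\<in>P. complete_edges C)"
    proof
      assume e: "e \<in> edges G"
      then have card_e: "card e = 2" and "e \<subseteq> verts G" using G by (auto simp: simple_graph_def)
      then obtain u v where uv: "e = {u, v}" "u \<in> verts G" "v \<in> verts G"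
        by (auto simp: card_2_iff)
      then show "e \<in> (\<Union>C\<in>P. complete_edges C)"
        using clique[OF uv(2,3)] e card_e by (auto simp: E_def complete_edges_def)
    next
      assume "e \<in> (\<Union>C\<in>P. complete_edges C)"
      then obtain C where C: "C \<in> P" "e \<subseteq> C" "card e = 2" by (auto simp: complete_edges_def)
      then obtain u v where uv: "e = {u, v}" "u \<noteq> v" by (auto simp: card_2_iff)
      moreover have "C \<subseteq> verts G" using Union_clique_partition[OF P] C(1) by blast
      ultimately have "E u v" using clique[of u v] C by auto
      then show "e \<in> edges G" using uv by (simp add: E_def)
    qed
  qed
  then show "disjoint_union_of_cliques (card (verts T) - 1) G"
    unfolding disjoint_union_of_cliques_def using P card_T
    by (intro exI[of _ P]) (simp add: clique_partition_def)
qed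

end
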